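(* For all positive constants $a_0,c_0,u_0$ there exist positive constants $C=C(a_0,c_0,u_0)$ and $A=A(a_0,c_0,u_0)$ such that the following holds. Let $\lambda_0\ge0$, let $(\boldsymbol{\Omega}^*_{\lambda_0},\boldsymbol{\delta}^*_{\lambda_0})$ be the oracle solution associated with $\lambda_0$, let $S$ be the support of $\mathbf{x}^*_{\lambda_0}=[\operatorname{vec}(\boldsymbol{\Omega}^*_{\lambda_0})^{\top},(\boldsymbol{\delta}^*_{\lambda_0})^{\top}]^{\top}$, $s_0=|S|$, $k_0=\max\{s_0,R(\boldsymbol{\Omega}^*_{\lambda_0},\boldsymbol{\delta}^*_{\lambda_0})\}$, and $\Delta_n=\max\{|\widehat{\boldsymbol{\Sigma}}_k-\boldsymbol{\Sigma}_k|_\infty,|\widehat{\boldsymbol{\mu}}_k-\boldsymbol{\mu}_k|_\infty: k=1,2\}$. Suppose $\Theta(S,0)\ge c_0$, $\Theta(S,3)\ge a_0$, $R(\boldsymbol{\Omega}^*_{\lambda_0},\boldsymbol{\delta}^*_{\lambda_0})\ge u_0$, $4s_0\Delta_n^2\le a_0c_0$ and $\max\{s_0\Delta_n,\ s_0^{1/2}k_0^{1/2}\lambda_0\}<1$. Then for any $\eta>1$, if $$\lambda=C\eta\max\{s_0^{1/2}\Delta_n,\ k_0^{1/2}\lambda_0\}\,[R(\boldsymbol{\Omega}^*_{\lambda_0},\boldsymbol{\delta}^*_{\lambda_0})]^{-1/2},$$ then the QUADRO estimate $(\widehat{\boldsymbol{\Omega}},\widehat{\boldsymbol{\delta}})$ with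 tuning parameter $\lambda$ satisfies $$\frac{R(\widehat{\boldsymbol{\Omega}},\widehat{\boldsymbol{\delta}})}{R(\boldsymbol{\Omega}^*_{\lambda_0},\boldsymbol{\delta}^*_{\lambda_0})}\ge1-A\eta^2\max\{s_0\Delta_n,\ s_0^{1/2}k_0^{1/2}\lambda_0\}.$$
   Context: Fix known $\pi\in(0,1)$, $\kappa=(1-\pi)/\pi$ and $\gamma\ge0$ (constants may depend on these fixed parameters). Let $\boldsymbol{\mu}_1,\boldsymbol{\mu}_2\in\mathbb{R}^d$ be the class means and $\boldsymbol{\Sigma}_1,\boldsymbol{\Sigma}_2$ the positive definite $d\times d$ class covariance matrices, with estimates $\widehat{\boldsymbol{\mu}}_k\in\mathbb{R}^d$ and $\widehat{\boldsymbol{\Sigma}}_k$ (symmetric positive semidefinite), $k=1,2$. $|\cdot|_q$ is the elementwise $\ell_q$ norm of a vector or matrix, $|\cdot|=|\cdot|_2$; $\operatorname{vec}$ stacks columns; $\otimes$ is the Kronecker product. Standing assumptions: $\max\{|\boldsymbol{\Sigma}_k|_\infty,|\boldsymbol{\mu}_k|_\infty: k=1,2\}\le1$, $|\widehat{\boldsymbol{\Sigma}}_k-\boldsymbol{\Sigma}_k|_\infty\le|\boldsymbol{\Sigma}_k|_\infty$ and $|\widehat{\boldsymbol{\mu}}_k-\boldsymbol{\mu}_k|_\infty\le|\boldsymbol{\mu}_k|_\infty$ for $k=1,2$. For a $d\times d$ matrix $\boldsymbol{\Omega}$ (no symmetry constraint is imposed) and $\boldsymbol{\delta}\in\mathbb{R}^d$,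 define $$M(\boldsymbol{\Omega},\boldsymbol{\delta})=-\boldsymbol{\mu}_1^{\top}\boldsymbol{\Omega}\boldsymbol{\mu}_1+\boldsymbol{\mu}_2^{\top}\boldsymbol{\Omega}\boldsymbol{\mu}_2+2(\boldsymbol{\mu}_1-\boldsymbol{\mu}_2)^{\top}\boldsymbol{\delta}-\operatorname{tr}(\boldsymbol{\Omega}(\boldsymbol{\Sigma}_1-\boldsymbol{\Sigma}_2)),$$ $$L_k(\boldsymbol{\Omega},\boldsymbol{\delta})=2(1+\gamma)\operatorname{tr}(\boldsymbol{\Omega}^{\top}\boldsymbol{\Sigma}_k\boldsymbol{\Omega}\boldsymbol{\Sigma}_k)+\gamma[\operatorname{tr}(\boldsymbol{\Omega}\boldsymbol{\Sigma}_k)]^2+4(\boldsymbol{\Omega}\boldsymbol{\mu}_k-\boldsymbol{\delta})^{\top}\boldsymbol{\Sigma}_k(\boldsymbol{\Omega}\boldsymbol{\mu}_k-\boldsymbol{\delta}),$$ $L=L_1+\kappa L_2$, and the Rayleigh quotient $R(\boldsymbol{\Omega},\boldsymbol{\delta})=[M(\boldsymbol{\Omega},\boldsymbol{\delta})]^2/L(\boldsymbol{\Omega},\boldsymbol{\delta})$. Let $\widehat M,\widehat L$ be obtained from $M,L$ by replacing $(\boldsymbol{\mu}_k,\boldsymbol{\Sigma}_k)$ with $(\widehat{\boldsymbol{\mu}}_k,\widehat{\boldsymbol{\Sigma}}_k)$, $k=1,2$. The QUADRO estimate with tuning parameter $\lambda$ is (a minimizer) $$(\widehat{\boldsymbol{\Omega}},\widehat{\boldsymbol{\delta}})=\operatorname*{argmin}_{(\boldsymbol{\Omega},\boldsymbol{\delta}):\,\widehat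 M(\boldsymbol{\Omega},\boldsymbol{\delta})=1}\{\widehat L(\boldsymbol{\Omega},\boldsymbol{\delta})+\lambda|\boldsymbol{\Omega}|_1+\lambda|\boldsymbol{\delta}|_1\}.$$ For $\lambda_0\ge0$, the oracle solution associated with $\lambda_0$ is (a minimizer) $$(\boldsymbol{\Omega}^*_{\lambda_0},\boldsymbol{\delta}^*_{\lambda_0})=\operatorname*{argmin}_{(\boldsymbol{\Omega},\boldsymbol{\delta}):\,M(\boldsymbol{\Omega},\boldsymbol{\delta})=1}\{L(\boldsymbol{\Omega},\boldsymbol{\delta})+\lambda_0|\boldsymbol{\Omega}|_1+\lambda_0|\boldsymbol{\delta}|_1\}.$$ Restricted eigenvalue: for $k=1,2$ let $$\mathbf{Q}_k=\begin{pmatrix}\bigl(2(1+\gamma)\boldsymbol{\Sigma}_k+4\boldsymbol{\mu}_k\boldsymbol{\mu}_k^{\top}\bigr)\otimes\boldsymbol{\Sigma}_k+\gamma\operatorname{vec}(\boldsymbol{\Sigma}_k)\operatorname{vec}(\boldsymbol{\Sigma}_k)^{\top}&-4\boldsymbol{\mu}_k\otimes\boldsymbol{\Sigma}_k\\-4\boldsymbol{\mu}_k^{\top}\otimes\boldsymbol{\Sigma}_k&4\boldsymbol{\Sigma}_k\end{pmatrix},\qquad\mathbf{Q}=\mathbf{Q}_1+\kappa\mathbf{Q}_2.$$ For $S\subset\{1,\ldots,d^2+d\}$ and $\bar c\ge0$, $$\Theta(S;\bar c)=\min_{\mathbf{v}\in\mathbb{R}^{d^2+d}:\ |\mathbf{v}_{S^c}|_1\le\bar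 c|\mathbf{v}_S|_1}\frac{\mathbf{v}^{\top}\mathbf{Q}\mathbf{v}}{|\mathbf{v}_S|^2}$$ (over $\mathbf{v}$ with $\mathbf{v}_S\ne0$). *)

theory Defs
  imports Complex_Main "Jordan_Normal_Form.Matrix"
begin

(* The dimension d is quantified inside the scope of the constants C and A, so vectors and
   matrices live in carrier_vec d and carrier_mat d d rather than in types indexed by d.
   Indices start at 0: {1, ..., d^2 + d} is rendered as {..<d^2 + d}. *)

definition vec_l1 :: "real vec \<Rightarrow> real" where
  "vec_l1 v = (\<Sum>i<dim_vec v. \<bar>v $ i\<bar>)"

definition mat_l1 :: "real mat \<Rightarrow> real" where
  "mat_l1 A = (\<Sum>i<dim_row A. \<Sum>j<dim_col A. \<bar>A $$ (i, j)\<bar>)"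

(* Elementwise maximum norms, only used in dimension at least 1. *)
definition vec_linf :: "real vec \<Rightarrow> real" where
  "vec_linf v = Max ((\<lambda>i. \<bar>v $ i\<bar>) ` {..<dim_vec v})"

definition mat_linf :: "real mat \<Rightarrow> real" where
  "mat_linf A = Max ((\<lambda>ij. \<bar>A $$ ij\<bar>) ` ({..<dim_row A} \<times> {..<dim_col A}))"

definition mat_trace :: "real mat \<Rightarrow> real" where
  "mat_trace A = (\<Sum>i<dim_row A. A $$ (i, i))"

(* Both notions include symmetry. *)
definition pos_def :: "nat \<Rightarrow> real mat \<Rightarrow> bool" where
  "pos_def d A \<longleftrightarrow> A \<in> carrier_mat d d \<and> transpose_mat A = A \<and>
     (\<forall>v \<in> carrier_vec d. v \<noteq> 0\<^sub>v d \<longrightarrow> v \<bullet> (A *\<^sub>v v) > 0)"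

definition pos_semidef :: "nat \<Rightarrow> real mat \<Rightarrow> bool" where
  "pos_semidef d A \<longleftrightarrow> A \<in> carrier_mat d d \<and> transpose_mat A = A \<and>
     (\<forall>v \<in> carrier_vec d. v \<bullet> (A *\<^sub>v v) \<ge> 0)"

(* Column stacking: entry (r, c) goes to position c * dim_row A + r. *)
definition vec_stack :: "real mat \<Rightarrow> real vec" where
  "vec_stack A = vec (dim_row A * dim_col A) (\<lambda>i. A $$ (i mod dim_row A, i div dim_row A))"

definition kron :: "real mat \<Rightarrow> real mat \<Rightarrow> real mat" where
  "kron A B = mat (dim_row A * dim_row B) (dim_col A * dim_col B)
     (\<lambda>(i, j). A $$ (i div dim_row B, j div dim_col B) * B $$ (i mod dim_row B, j mod dim_col B))"

definition mat_of_col :: "real vec \<Rightarrow> real mat" where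
  "mat_of_col v = transpose_mat (mat_of_row v)"

definition quadro_M ::
  "real vec \<Rightarrow> real vec \<Rightarrow> real mat \<Rightarrow> real mat \<Rightarrow> real mat \<Rightarrow> real vec \<Rightarrow> real" where
  "quadro_M \<mu>\<^sub>1 \<mu>\<^sub>2 \<Sigma>\<^sub>1 \<Sigma>\<^sub>2 \<Omega> \<delta> =
     - (\<mu>\<^sub>1 \<bullet> (\<Omega> *\<^sub>v \<mu>\<^sub>1)) + \<mu>\<^sub>2 \<bullet> (\<Omega> *\<^sub>v \<mu>\<^sub>2) + 2 * ((\<mu>\<^sub>1 - \<mu>\<^sub>2) \<bullet> \<delta>)
     - mat_trace (\<Omega> * (\<Sigma>\<^sub>1 - \<Sigma>\<^sub>2))"

definition quadro_Lk :: "real \<Rightarrow> real vec \<Rightarrow> real mat \<Rightarrow> real mat \<Rightarrow> real vec \<Rightarrow> real" where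
  "quadro_Lk \<gamma> \<mu> \<Sigma> \<Omega> \<delta> =
     2 * (1 + \<gamma>) * mat_trace (transpose_mat \<Omega> * \<Sigma> * \<Omega> * \<Sigma>) + \<gamma> * (mat_trace (\<Omega> * \<Sigma>))\<^sup>2
     + 4 * ((\<Omega> *\<^sub>v \<mu> - \<delta>) \<bullet> (\<Sigma> *\<^sub>v (\<Omega> *\<^sub>v \<mu> - \<delta>)))"

definition quadro_L ::
  "real \<Rightarrow> real \<Rightarrow> real vec \<Rightarrow> real vec \<Rightarrow> real mat \<Rightarrow> real mat \<Rightarrow> real mat \<Rightarrow> real vec \<Rightarrow> real" where
  "quadro_L \<gamma> \<kappa> \<mu>\<^sub>1 \<mu>\<^sub>2 \<Sigma>\<^sub>1 \<Sigma>\<^sub>2 \<Omega> \<delta> =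
     quadro_Lk \<gamma> \<mu>\<^sub>1 \<Sigma>\<^sub>1 \<Omega> \<delta> + \<kappa> * quadro_Lk \<gamma> \<mu>\<^sub>2 \<Sigma>\<^sub>2 \<Omega> \<delta>"

definition rayleigh ::
  "real \<Rightarrow> real \<Rightarrow> real vec \<Rightarrow> real vec \<Rightarrow> real mat \<Rightarrow> real mat \<Rightarrow> real mat \<Rightarrow> real vec \<Rightarrow> real" where
  "rayleigh \<gamma> \<kappa> \<mu>\<^sub>1 \<mu>\<^sub>2 \<Sigma>\<^sub>1 \<Sigma>\<^sub>2 \<Omega> \<delta> =
     (quadro_M \<mu>\<^sub>1 \<mu>\<^sub>2 \<Sigma>\<^sub>1 \<Sigma>\<^sub>2 \<Omega> \<delta>)\<^sup>2 / quadro_L \<gamma> \<kappa> \<mu>\<^sub>1 \<mu>\<^sub>2 \<Sigma>\<^sub>1 \<Sigma>\<^sub>2 \<Omega> \<delta>"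

(* (Omega, delta) is a minimizer of the penalized problem with penalty level l.  Instantiated with
   the population parameters this is an oracle solution, with the estimated parameters a QUADRO
   estimate.  Omega is not required to be symmetric. *)
definition quadro_solution ::
  "nat \<Rightarrow> real \<Rightarrow> real \<Rightarrow> real vec \<Rightarrow> real vec \<Rightarrow> real mat \<Rightarrow> real mat \<Rightarrow> real \<Rightarrow>
   real mat \<Rightarrow> real vec \<Rightarrow> bool" where
  "quadro_solution d \<gamma> \<kappa> \<mu>\<^sub>1 \<mu>\<^sub>2 \<Sigma>\<^sub>1 \<Sigma>\<^sub>2 l \<Omega> \<delta> \<longleftrightarrow>
     is_arg_min
       (\<lambda>(\<Omega>, \<delta>). quadro_L \<gamma> \<kappa> \<mu>\<^sub>1 \<mu>\<^sub>2 \<Sigma>\<^sub>1 \<Sigma>\<^sub>2 \<Omega> \<delta> + l * mat_l1 \<Omega> + l * vec_l1 \<delta>)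
       (\<lambda>(\<Omega>, \<delta>). \<Omega> \<in> carrier_mat d d \<and> \<delta> \<in> carrier_vec d \<and>
                quadro_M \<mu>\<^sub>1 \<mu>\<^sub>2 \<Sigma>\<^sub>1 \<Sigma>\<^sub>2 \<Omega> \<delta> = 1)
       (\<Omega>, \<delta>)"

definition quadro_Qk :: "real \<Rightarrow> real vec \<Rightarrow> real mat \<Rightarrow> real mat" where
  "quadro_Qk \<gamma> \<mu> \<Sigma> = four_block_mat
     (kron ((2 * (1 + \<gamma>)) \<cdot>\<^sub>m \<Sigma> + 4 \<cdot>\<^sub>m (mat_of_col \<mu> * mat_of_row \<mu>)) \<Sigma>
        + \<gamma> \<cdot>\<^sub>m (mat_of_col (vec_stack \<Sigma>) * mat_of_row (vec_stack \<Sigma>)))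
     ((-4) \<cdot>\<^sub>m kron (mat_of_col \<mu>) \<Sigma>)
     ((-4) \<cdot>\<^sub>m kron (mat_of_row \<mu>) \<Sigma>)
     (4 \<cdot>\<^sub>m \<Sigma>)"

definition quadro_Q ::
  "real \<Rightarrow> real \<Rightarrow> real vec \<Rightarrow> real vec \<Rightarrow> real mat \<Rightarrow> real mat \<Rightarrow> real mat" where
  "quadro_Q \<gamma> \<kappa> \<mu>\<^sub>1 \<mu>\<^sub>2 \<Sigma>\<^sub>1 \<Sigma>\<^sub>2 = quadro_Qk \<gamma> \<mu>\<^sub>1 \<Sigma>\<^sub>1 + \<kappa> \<cdot>\<^sub>m quadro_Qk \<gamma> \<mu>\<^sub>2 \<Sigma>\<^sub>2"

(* The quotient is invariant under scaling of v, so for nonempty S the infimum is attained (restrict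
   to the compact set of admissible v with unit l2 norm on S) and is the minimum.  For S = {} the
   set is empty and the value is unspecified. *)
definition restricted_eigenvalue :: "real mat \<Rightarrow> nat set \<Rightarrow> real \<Rightarrow> real" where
  "restricted_eigenvalue Q S c = Inf {(v \<bullet> (Q *\<^sub>v v)) / (\<Sum>i\<in>S. (v $ i)\<^sup>2) | v.
     v \<in> carrier_vec (dim_row Q) \<and> (\<exists>i\<in>S. v $ i \<noteq> 0) \<and>
     (\<Sum>i\<in>{..<dim_row Q} - S. \<bar>v $ i\<bar>) \<le> c * (\<Sum>i\<in>S. \<bar>v $ i\<bar>)}"

definition vec_support :: "real vec \<Rightarrow> nat set" where
  "vec_support v = {i. i < dim_vec v \<and> v $ i \<noteq> 0}"

end

theory Submission
  imports Defs
begin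

text \<open>
  In the stacked coordinates \<open>x = (vec \<Omega>, \<delta>)\<close> the functional \<open>M\<close> is linear and \<open>L\<close> is the quadratic
  form of \<open>Q\<close>; the sample versions differ from these by entries of size \<open>O(\<Delta>)\<close>. Write \<open>x\<close> for the oracle
  solution, \<open>y\<close> for the estimate, \<open>z\<close> for the multiple of \<open>x\<close> that is feasible for the sample problem,
  and \<open>h = y - z\<close>. Optimality of \<open>x\<close> bounds \<open>z\<^sup>T Q h\<close> by a small multiple of \<open>\<lambda> |h|\<^sub>1\<close>: up to a
  multiple of \<open>x\<close> of size \<open>O(\<Delta> |h|\<^sub>1)\<close>, the direction \<open>h\<close> is tangent to the constraint \<open>M = 1\<close>.
  Comparing \<open>y\<close> with \<open>z\<close> in the sample problem then puts \<open>h\<close> into the cone of the restricted eigenvalue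
  condition, which gives \<open>h\<^sup>T Q h \<le> 9 \<lambda>\<^sup>2 s\<^sub>0 / a\<^sub>0\<close> and \<open>|h|\<^sub>1 \<le> 12 \<lambda> s\<^sub>0 / a\<^sub>0\<close>. Hence \<open>M(y)\<close> and \<open>L(y)\<close>
  are close to \<open>M(z)\<close> and \<open>L(z)\<close>, and the Rayleigh quotient of \<open>z\<close> is that of \<open>x\<close>.
\<close>

section \<open>Penalized quadratic forms\<close>

definition bil :: "'i set \<Rightarrow> ('i \<Rightarrow> 'i \<Rightarrow> real) \<Rightarrow> ('i \<Rightarrow> real) \<Rightarrow> ('i \<Rightarrow> real) \<Rightarrow> real" where
  "bil I Q x y = (\<Sum>i\<in>I. \<Sum>j\<in>I. x i * Q i j * y j)"

definition lin :: "'i set \<Rightarrow> ('i \<Rightarrow> real) \<Rightarrow> ('i \<Rightarrow> real) \<Rightarrow> real" where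
  "lin I m x = (\<Sum>i\<in>I. m i * x i)"

definition l1 :: "'i set \<Rightarrow> ('i \<Rightarrow> real) \<Rightarrow> real" where
  "l1 I x = (\<Sum>i\<in>I. \<bar>x i\<bar>)"

lemma l1_nonneg [simp]: "0 \<le> l1 I x"
  by (simp add: l1_def sum_nonneg)

lemma l1_scale: "l1 I (\<lambda>i. e * x i) = \<bar>e\<bar> * l1 I x"
  by (simp add: l1_def abs_mult sum_distrib_left)

lemma l1_add_scale: "l1 I (\<lambda>i. x i + e * y i) \<le> l1 I x + \<bar>e\<bar> * l1 I y"
proof -
  have "l1 I (\<lambda>i. x i + e * y i) \<le> (\<Sum>i\<in>I. \<bar>x i\<bar> + \<bar>e\<bar> * \<bar>y i\<bar>)"
    unfolding l1_def by (intro sum_mono) (metis abs_mult abs_triangle_ineq)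
  then show ?thesis by (simp add: l1_def sum.distrib sum_distrib_left)
qed

lemma lin_add_scale: "lin I m (\<lambda>i. x i + e * y i) = lin I m x + e * lin I m y"
  by (simp add: lin_def algebra_simps sum.distrib sum_distrib_left)

lemma lin_scale: "lin I m (\<lambda>i. e * y i) = e * lin I m y"
  by (simp add: lin_def algebra_simps sum_distrib_left)

lemma bil_add_scale_right:
  "bil I Q x (\<lambda>i. y i + e * z i) = bil I Q x y + e * bil I Q x z"
  by (simp add: bil_def algebra_simps sum.distrib sum_distrib_left)

lemma bil_add_scale_left:
  "bil I Q (\<lambda>i. y i + e * z i) x = bil I Q y x + e * bil I Q z x"
  by (simp add: bil_def algebra_simps sum.distrib sum_distrib_left)

lemma bil_scale:
  "bil I Q (\<lambda>i. e * z i) x = e * bil I Q z x" "bil I Q x (\<lambda>i. e * z i) = e * bil I Q x z"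
  by (simp_all add: bil_def algebra_simps sum_distrib_left)

lemma bil_commute:
  assumes "\<And>i j. i \<in> I \<Longrightarrow> j \<in> I \<Longrightarrow> Q i j = Q j i"
  shows "bil I Q x y = bil I Q y x"
proof -
  have "bil I Q x y = (\<Sum>j\<in>I. \<Sum>i\<in>I. x i * Q i j * y j)"
    unfolding bil_def by (rule sum.swap)
  also have "\<dots> = bil I Q y x"
    unfolding bil_def by (intro sum.cong refl) (simp add: assms mult_ac)
  finally show ?thesis .
qed

lemma bil_square_add_scale:
  assumes "\<And>i j. i \<in> I \<Longrightarrow> j \<in> I \<Longrightarrow> Q i j = Q j i"
  shows "bil I Q (\<lambda>i. x i + e * w i) (\<lambda>i. x i + e * w i)
    = bil I Q x x + 2 * e * bil I Q x w + e\<^sup>2 * bil I Q w w"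
proof -
  have "bil I Q w x = bil I Q x w" by (rule bil_commute) (use assms in auto)
  then show ?thesis
    by (simp add: bil_add_scale_left bil_add_scale_right algebra_simps power2_eq_square)
qed

section \<open>Perturbation of linear and quadratic forms in the l1 norm\<close>

lemma lin_diff_bound:
  assumes "\<And>i. i \<in> I \<Longrightarrow> \<bar>m' i - m i\<bar> \<le> q"
  shows "\<bar>lin I m' x - lin I m x\<bar> \<le> q * l1 I x"
proof -
  have "lin I m' x - lin I m x = (\<Sum>i\<in>I. (m' i - m i) * x i)"
    by (simp add: lin_def sum_subtractf algebra_simps)
  also have "\<bar>\<dots>\<bar> \<le> (\<Sum>i\<in>I. \<bar>(m' i - m i) * x i\<bar>)" by (rule sum_abs)
  also have "\<dots> \<le> (\<Sum>i\<in>I. q * \<bar>x i\<bar>)"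
    by (intro sum_mono) (simp add: abs_mult assms mult_right_mono)
  finally show ?thesis by (simp add: l1_def sum_distrib_left)
qed

lemma bil_diff_bound:
  assumes "\<And>i j. i \<in> I \<Longrightarrow> j \<in> I \<Longrightarrow> \<bar>Q' i j - Q i j\<bar> \<le> q"
  shows "\<bar>bil I Q' x y - bil I Q x y\<bar> \<le> q * l1 I x * l1 I y"
proof -
  have "bil I Q' x y - bil I Q x y = (\<Sum>i\<in>I. \<Sum>j\<in>I. x i * (Q' i j - Q i j) * y j)"
    by (simp add: bil_def sum_subtractf algebra_simps)
  also have "\<bar>\<dots>\<bar> \<le> (\<Sum>i\<in>I. \<Sum>j\<in>I. \<bar>x i * (Q' i j - Q i j) * y j\<bar>)"
    by (rule order_trans[OF sum_abs], rule sum_mono, rule sum_abs)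
  also have "\<dots> \<le> (\<Sum>i\<in>I. \<Sum>j\<in>I. q * (\<bar>x i\<bar> * \<bar>y j\<bar>))"
  proof (intro sum_mono)
    fix i j assume "i \<in> I" "j \<in> I"
    then have "\<bar>Q' i j - Q i j\<bar> * (\<bar>x i\<bar> * \<bar>y j\<bar>) \<le> q * (\<bar>x i\<bar> * \<bar>y j\<bar>)"
      by (intro mult_right_mono assms) auto
    then show "\<bar>x i * (Q' i j - Q i j) * y j\<bar> \<le> q * (\<bar>x i\<bar> * \<bar>y j\<bar>)"
      by (simp add: abs_mult mult_ac)
  qed
  also have "\<dots> = q * (\<Sum>i\<in>I. \<Sum>j\<in>I. \<bar>x i\<bar> * \<bar>y j\<bar>)" by (simp add: sum_distrib_left)
  also have "(\<Sum>i\<in>I. \<Sum>j\<in>I. \<bar>x i\<bar> * \<bar>y j\<bar>) = l1 I x * l1 I y"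
    by (simp add: l1_def sum_product)
  finally show ?thesis by (simp add: mult_ac)
qed

text \<open>Cauchy-Schwarz against the constant vector, obtained by expanding the double sum of
  \<open>(\<bar>x i\<bar> - \<bar>x j\<bar>)\<^sup>2\<close>. For infinite \<open>S\<close> both
  sides are 0 by convention.\<close>

lemma l1_squared_le:
  shows "(l1 S x)\<^sup>2 \<le> real (card S) * (\<Sum>i\<in>S. (x i)\<^sup>2)"
proof -
  have "0 \<le> (\<Sum>i\<in>S. \<Sum>j\<in>S. (\<bar>x i\<bar> - \<bar>x j\<bar>)\<^sup>2)" by (intro sum_nonneg) simp
  also have "\<dots> = (\<Sum>i\<in>S. \<Sum>j\<in>S. (x i)\<^sup>2) + (\<Sum>i\<in>S. \<Sum>j\<in>S. (x j)\<^sup>2)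
      - 2 * (\<Sum>i\<in>S. \<Sum>j\<in>S. \<bar>x i\<bar> * \<bar>x j\<bar>)"
    by (simp add: power2_diff sum.distrib sum_subtractf sum_distrib_left mult.assoc)
  also have "(\<Sum>i\<in>S. \<Sum>j\<in>S. \<bar>x i\<bar> * \<bar>x j\<bar>) = (l1 S x)\<^sup>2"
    by (simp add: l1_def power2_eq_square sum_product)
  finally show ?thesis by (simp flip: sum_distrib_left)
qed

section \<open>Stationarity, ratio and cone inequalities\<close>

lemma nonneg_linear_coeff:
  fixes p q :: real
  assumes "\<And>e. e > 0 \<Longrightarrow> 0 \<le> e * p + e\<^sup>2 * q"
  shows "0 \<le> p"
proof (rule ccontr)
  assume "\<not> 0 \<le> p"
  \<comment> \<open>With this step length \<open>e * \<bar>q\<bar>\<close> stays below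
    \<open>- p / 2\<close>, so the quadratic term cannot offset the negative linear one.\<close>
  define e where "e = - p / (2 * (\<bar>q\<bar> + 1))"
  have e: "e > 0" using \<open>\<not> 0 \<le> p\<close> by (simp add: e_def field_simps)
  have "e * (\<bar>q\<bar> + 1) = - p / 2" by (simp add: e_def field_simps)
  moreover have "e * q \<le> e * (\<bar>q\<bar> + 1)" using e by (intro mult_left_mono) auto
  ultimately have "p + e * q < 0" using \<open>\<not> 0 \<le> p\<close> by linarith
  then have "e * (p + e * q) < 0" using e by (simp add: mult_pos_neg)
  then show False using assms[OF e] by (simp add: algebra_simps power2_eq_square)
qed

text \<open>A subgradient-free form of the stationarity condition.\<close>

lemma penalized_minimizer_stationary:
  assumes sym: "\<And>i j. i \<in> I \<Longrightarrow> j \<in> I \<Longrightarrow> Q i j = Q j i"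
    and "l \<ge> 0" and x: "lin I m x = 1" and w: "lin I m w = 0"
    and opt: "\<And>y. lin I m y = 1 \<Longrightarrow> bil I Q x x + l * l1 I x \<le> bil I Q y y + l * l1 I y"
  shows "\<bar>2 * bil I Q x w\<bar> \<le> l * l1 I w"
proof -
  \<comment> \<open>Moving from \<open>x\<close> along \<open>\<sigma> * w\<close> keeps the
    constraint and raises the penalty by at most \<open>e * (l * l1 I w)\<close>, so the first-order
    term in \<open>e\<close> must be nonnegative. The two signs of \<sigma> together give the
    absolute value.\<close>
  have *: "0 \<le> 2 * \<sigma> * bil I Q x w + l * l1 I w" if "\<bar>\<sigma>\<bar> = 1" for \<sigma> :: real
  proof (rule nonneg_linear_coeff)
    fix e :: real assume "e > 0"
    let ?y = "\<lambda>i. x i + (e * \<sigma>) * w i"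
    have "l * l1 I ?y \<le> l * (l1 I x + \<bar>e * \<sigma>\<bar> * l1 I w)"
      using l1_add_scale \<open>l \<ge> 0\<close> by (intro mult_left_mono) auto
    also have "\<bar>e * \<sigma>\<bar> = e" using that \<open>e > 0\<close> by (simp add: abs_mult)
    finally have "l * l1 I ?y \<le> l * l1 I x + e * (l * l1 I w)" by (simp add: algebra_simps)
    moreover have "bil I Q x x + l * l1 I x \<le> bil I Q ?y ?y + l * l1 I ?y"
      by (rule opt) (simp add: lin_add_scale x w)
    moreover have "bil I Q ?y ?y = bil I Q x x + 2 * (e * \<sigma>) * bil I Q x w + (e * \<sigma>)\<^sup>2 * bil I Q w w"
      by (rule bil_square_add_scale) (use sym in auto)
    moreover have "\<sigma>\<^sup>2 = 1" using that by (metis abs_1 power2_abs power_one)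
    ultimately show "0 \<le> e * (2 * \<sigma> * bil I Q x w + l * l1 I w) + e\<^sup>2 * bil I Q w w"
      by (simp add: algebra_simps power_mult_distrib)
  qed
  from *[of 1] *[of "-1"] show ?thesis by simp
qed

text \<open>In the application \<tau> is the value of M at the rescaled oracle, whose value of L
  times \<open>R\<close> is \<open>\<tau>\<^sup>2\<close>; \<open>e\<^sub>1\<close> and
  \<open>e\<^sub>2\<close> are the errors made in passing to the estimate. The weights 3 and 9/4
  come from \<open>2/3 \<le> \<tau>\<close>, which gives
  \<open>2 * \<tau> \<le> 3 * \<tau>\<^sup>2\<close> and
  \<open>1 \<le> 9/4 * \<tau>\<^sup>2\<close>.\<close>

lemma rayleigh_ratio_lower_bound:
  fixes \<tau> e\<^sub>1 e\<^sub>2 M P :: real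
  assumes "2/3 \<le> \<tau>" "0 \<le> e\<^sub>1" "0 \<le> e\<^sub>2" "e\<^sub>1 \<le> \<tau>" "\<tau> - e\<^sub>1 \<le> M" "0 < P" "P \<le> \<tau>\<^sup>2 + e\<^sub>2"
  shows "1 - (3 * e\<^sub>1 + 9/4 * e\<^sub>2) \<le> M\<^sup>2 / P"
proof -
  let ?z = "3 * e\<^sub>1 + 9/4 * e\<^sub>2"
  have t2: "4/9 \<le> \<tau>\<^sup>2" using power_mono[OF assms(1), of 2] by (simp add: power2_eq_square)
  have a: "(\<tau> - e\<^sub>1)\<^sup>2 \<le> M\<^sup>2" using assms by (intro power_mono) auto
  have b: "2 * \<tau> * e\<^sub>1 \<le> 3 * \<tau>\<^sup>2 * e\<^sub>1"
  proof -
    have "0 \<le> \<tau> * e\<^sub>1 * (3 * \<tau> - 2)" using assms by (intro mult_nonneg_nonneg) auto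
    then show ?thesis by (simp add: algebra_simps power2_eq_square)
  qed
  have c: "e\<^sub>2 \<le> 9/4 * \<tau>\<^sup>2 * e\<^sub>2"
    using mult_right_mono[OF t2 \<open>0 \<le> e\<^sub>2\<close>] by simp
  have "(1 - ?z) * P \<le> M\<^sup>2"
  \<comment> \<open>Multiplying the bound on \<open>P\<close> by \<open>1 - ?z\<close> requires a
    nonnegative factor; in the other case the left side is already nonpositive.\<close>
  proof (cases "?z \<le> 1")
    case True
    have "(1 - ?z) * P \<le> (1 - ?z) * (\<tau>\<^sup>2 + e\<^sub>2)" using True assms by (intro mult_left_mono) auto
    also have "\<dots> = \<tau>\<^sup>2 + e\<^sub>2 - 3 * \<tau>\<^sup>2 * e\<^sub>1 - 9/4 * \<tau>\<^sup>2 * e\<^sub>2 - ?z * e\<^sub>2" by (simp add: algebra_simps)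
    also have "\<dots> \<le> \<tau>\<^sup>2 - 2 * \<tau> * e\<^sub>1"
    proof -
      have "0 \<le> ?z * e\<^sub>2" using assms by auto
      then show ?thesis using b c by linarith
    qed
    also have "\<dots> \<le> (\<tau> - e\<^sub>1)\<^sup>2" by (simp add: power2_diff)
    finally show ?thesis using a by linarith
  next
    case False
    then have "(1 - ?z) * P \<le> 0" using assms by (intro mult_nonpos_nonneg) auto
    then show ?thesis by (meson order_trans zero_le_power2)
  qed
  then show ?thesis using assms by (simp add: le_divide_eq)
qed

lemma l1_split:
  assumes "finite I" "S \<subseteq> I"
  shows "l1 I x = l1 S x + l1 (I - S) x"
  unfolding l1_def using assms by (metis add.commute sum.subset_diff)

text \<open>Division-free form of the bound \<open>a\<close> from below on the restricted
  eigenvalue. Vectors that vanish on \<open>S\<close> need no exclusion: for them it only asks that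
  the form be nonnegative.\<close>

definition cone_lower_bound :: "'i set \<Rightarrow> ('i \<Rightarrow> 'i \<Rightarrow> real) \<Rightarrow> 'i set \<Rightarrow> real \<Rightarrow> real \<Rightarrow> bool" where
  "cone_lower_bound I Q S c a \<longleftrightarrow>
     (\<forall>v. l1 (I - S) v \<le> c * l1 S v \<longrightarrow> a * (\<Sum>i\<in>S. (v i)\<^sup>2) \<le> bil I Q v v)"

text \<open>Off \<open>S\<close> the penalty grows by all of \<open>l1 (I - S) u\<close>, because
  \<open>x\<close> vanishes there; on \<open>S\<close> it drops by at most \<open>l1 S u\<close>.
  The cross term \<open>c\<close> can cancel half of \<open>l * l1 I u\<close>, which leaves weight
  \<open>l / 2\<close> off \<open>S\<close> against \<open>3/2 * l\<close> on \<open>S\<close>. The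
  ratio of these weights is the cone constant 3.\<close>

lemma cone_basic_inequality:
  assumes fin: "finite I" and S: "S \<subseteq> I" "\<And>i. i \<in> I - S \<Longrightarrow> x i = 0"
    and "l > 0" and q: "0 \<le> q" and c: "c \<ge> - (l / 2 * l1 I u)"
    and basic: "q + c + l * l1 I (\<lambda>i. x i + u i) \<le> l * l1 I x"
  shows "l1 (I - S) u \<le> 3 * l1 S u" "q \<le> 3/2 * l * l1 S u"
proof -
  have "l1 I (\<lambda>i. x i + u i) = l1 S (\<lambda>i. x i + u i) + l1 (I - S) (\<lambda>i. x i + u i)"
    by (rule l1_split[OF fin S(1)])
  also have "l1 (I - S) (\<lambda>i. x i + u i) = l1 (I - S) u"
    unfolding l1_def by (intro sum.cong) (auto simp: S)
  also have "l1 S x = l1 S (\<lambda>i. (x i + u i) + (-1) * u i)" by simp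
  then have "l1 S (\<lambda>i. x i + u i) \<ge> l1 S x - l1 S u"
    using l1_add_scale[of S "\<lambda>i. x i + u i" "-1" u] by simp
  moreover have "l1 I x = l1 S x"
    using l1_split[OF fin S(1), of x] S by (simp add: l1_def)
  ultimately have "l1 I x - l1 S u + l1 (I - S) u \<le> l1 I (\<lambda>i. x i + u i)" by simp
  then have "l * (l1 I x - l1 S u + l1 (I - S) u) \<le> l * l1 I (\<lambda>i. x i + u i)"
    using \<open>l > 0\<close> by simp
  moreover have "l1 I u = l1 S u + l1 (I - S) u" by (rule l1_split[OF fin S(1)])
  ultimately have *: "q + l / 2 * l1 (I - S) u \<le> 3/2 * l * l1 S u"
    using basic c by (simp add: algebra_simps) 
  have "0 \<le> l / 2 * l1 (I - S) u" using \<open>l > 0\<close> by simp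
  then show "q \<le> 3/2 * l * l1 S u" using * by linarith
  from * q have "l / 2 * l1 (I - S) u \<le> l / 2 * (3 * l1 S u)" by simp
  then show "l1 (I - S) u \<le> 3 * l1 S u" using \<open>l > 0\<close> by simp
qed

section \<open>Comparison of the estimate with the oracle\<close>

text \<open>
  The first two summands of \<open>A\<close> pay for the error in \<open>M\<close> and in \<open>L\<close>; the last two guarantee, when
  \<open>A \<eta>\<^sup>2 r < 1\<close>, that the sample value of \<open>M\<close> at the oracle is at least \<open>1/2\<close> and that the perturbation
  of \<open>Q\<close> is dominated by \<open>Q\<close> on the cone.
\<close>

locale penalized_rayleigh =
  fixes I S :: "'i set" and Q Q' :: "'i \<Rightarrow> 'i \<Rightarrow> real" and m m' x y :: "'i \<Rightarrow> real"
    and a c u cm cq C A l\<^sub>0 D \<eta> s R k r l :: real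
  assumes fin: "finite I" and S_subset: "S \<subseteq> I" and x_support: "\<And>i. i \<in> I - S \<Longrightarrow> x i = 0"
    and pos: "0 < a" "0 < c" "0 < u" "0 < cm" "0 < cq"
    and C_def: "C = 2 * (4 * cm / sqrt u + 3 + 4 * cq / sqrt c)"
    and A_def: "A = 3 * (12 * cm * C / (a * sqrt u)) + 9/4 * (15 * C\<^sup>2 / a)
      + 2 * cm / sqrt (c * u) + 32 * cq / a"
    and sym: "\<And>i j. i \<in> I \<Longrightarrow> j \<in> I \<Longrightarrow> Q i j = Q j i"
    and sym': "\<And>i j. i \<in> I \<Longrightarrow> j \<in> I \<Longrightarrow> Q' i j = Q' j i"
    and psd: "\<And>v. 0 \<le> bil I Q v v" and psd': "\<And>v. 0 \<le> bil I Q' v v"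
    and dev_lin: "\<And>i. i \<in> I \<Longrightarrow> \<bar>m' i - m i\<bar> \<le> cm * D"
    and dev_bil: "\<And>i j. i \<in> I \<Longrightarrow> j \<in> I \<Longrightarrow> \<bar>Q' i j - Q i j\<bar> \<le> cq * D"
    and D_nonneg: "0 \<le> D" and l\<^sub>0_nonneg: "0 \<le> l\<^sub>0" and eta: "1 < \<eta>"
    and x_feasible: "lin I m x = 1"
    and x_optimal: "\<And>v. lin I m v = 1 \<Longrightarrow> bil I Q x x + l\<^sub>0 * l1 I x \<le> bil I Q v v + l\<^sub>0 * l1 I v"
    and y_feasible: "lin I m' y = 1"
    and y_optimal: "\<And>v. lin I m' v = 1 \<Longrightarrow> bil I Q' y y + l * l1 I y \<le> bil I Q' v v + l * l1 I v"
    and cone_0: "cone_lower_bound I Q S 0 c" and cone_3: "cone_lower_bound I Q S 3 a"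
    and s_def: "s = real (card S)" and R_def: "R = 1 / bil I Q x x" and R_ge: "u \<le> R"
    and k_def: "k = max s R" and r_def: "r = max (s * D) (sqrt s * sqrt k * l\<^sub>0)"
    and r_less: "r < 1"
    and l_def: "l = C * \<eta> * max (sqrt s * D) (sqrt k * l\<^sub>0) / sqrt R"
begin

section \<open>Sizes of the oracle, the penalty and the deviations\<close>

lemma R_pos: "0 < R"
  using R_ge pos by linarith

lemma bil_x: "bil I Q x x = 1 / R"
  using R_pos by (simp add: R_def)

lemma C_pos: "0 < C"
  using pos by (simp add: C_def add_pos_pos)

text \<open>The zero vector violates the constraint \<open>lin I m x = 1\<close>, so
  \<open>S\<close> is nonempty.\<close>

lemma s_ge_1: "1 \<le> s"
proof -
  have "S \<noteq> {}"
  proof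
    assume "S = {}"
    then have "lin I m x = 0" using x_support by (simp add: lin_def)
    then show False using x_feasible by simp
  qed
  then have "card S \<noteq> 0" using fin S_subset by (simp add: finite_subset)
  then show ?thesis by (simp add: s_def)
qed

text \<open>Cauchy-Schwarz followed by the cone bound. It serves the oracle with cone constant 0 and
  the deviation \<open>h\<close> with cone constant 3.\<close>

lemma l1_le:
  assumes "cone_lower_bound I Q S g b" "0 < b" "l1 (I - S) v \<le> g * l1 S v"
  shows "(l1 S v)\<^sup>2 \<le> s * bil I Q v v / b"
proof -
  have "b * (l1 S v)\<^sup>2 \<le> b * (s * (\<Sum>i\<in>S. (v i)\<^sup>2))"
    unfolding s_def using l1_squared_le assms by (intro mult_left_mono) auto
  also have "\<dots> = s * (b * (\<Sum>i\<in>S. (v i)\<^sup>2))" by simp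
  also have "\<dots> \<le> s * bil I Q v v"
    using assms s_ge_1 by (intro mult_left_mono) (auto simp: cone_lower_bound_def)
  finally show ?thesis using \<open>0 < b\<close> by (simp add: le_divide_eq mult_ac)
qed

text \<open>The oracle is supported on \<open>S\<close>, so it lies in the cone with constant 0, and
  its form equals \<open>1 / R\<close>.\<close>

lemma l1_x: "l1 I x \<le> sqrt s / (sqrt c * sqrt R)"
proof -
  have "l1 (I - S) x = 0" using x_support by (simp add: l1_def)
  then have *: "l1 I x = l1 S x" using l1_split[OF fin S_subset, of x] by simp
  have "(l1 S x)\<^sup>2 \<le> s * bil I Q x x / c"
    by (rule l1_le[OF cone_0 pos(2)]) (simp add: \<open>l1 (I - S) x = 0\<close>)
  then have "l1 S x \<le> sqrt (s * bil I Q x x / c)" by (rule real_le_rsqrt)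
  then show ?thesis by (simp add: * bil_x real_sqrt_mult real_sqrt_divide mult_ac)
qed

lemma r_nonneg: "0 \<le> r"
  using s_ge_1 D_nonneg by (simp add: r_def le_max_iff_disj)

lemma sD_le: "s * D \<le> r"
  by (simp add: r_def)

lemma l_nonneg: "0 \<le> l"
  using C_pos eta s_ge_1 D_nonneg R_pos by (simp add: l_def le_max_iff_disj)

text \<open>Multiplying the maximum in the definition of \<open>l\<close> by \<open>sqrt s\<close>
  turns it into the maximum that defines \<open>r\<close>.\<close>

lemma l_sqrt_s: "l * sqrt s = C * \<eta> * r / sqrt R"
proof -
  have "max (sqrt s * D) (sqrt k * l\<^sub>0) * sqrt s = max (sqrt s * D * sqrt s) (sqrt k * l\<^sub>0 * sqrt s)"
    using s_ge_1 by (intro max_mult_distrib_right[THEN trans]) auto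
  also have "\<dots> = r"
  proof -
    have "sqrt s * D * sqrt s = s * D" "sqrt k * l\<^sub>0 * sqrt s = sqrt s * sqrt k * l\<^sub>0"
      using s_ge_1 by (simp_all add: mult_ac)
    then show ?thesis by (simp only: r_def)
  qed
  finally have *: "max (sqrt s * D) (sqrt k * l\<^sub>0) * sqrt s = r" .
  have "l * sqrt s = C * \<eta> * (max (sqrt s * D) (sqrt k * l\<^sub>0) * sqrt s) / sqrt R"
    by (simp add: l_def)
  then show ?thesis by (simp only: *)
qed

text \<open>Together with the next lemma this inverts the choice of \<open>l\<close>: each branch of
  its maximum is bounded by \<open>l\<close> with a factor \<open>1 / C\<close>, which a large
  \<open>C\<close> makes small.\<close>

lemma D_le: "D * sqrt s \<le> l * sqrt R / C"
proof -
  have "D * sqrt s \<le> max (sqrt s * D) (sqrt k * l\<^sub>0)" by (simp add: mult_ac)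
  also have "\<dots> \<le> \<eta> * max (sqrt s * D) (sqrt k * l\<^sub>0)"
    using eta D_nonneg s_ge_1
      mult_right_mono[of 1 \<eta> "max (sqrt s * D) (sqrt k * l\<^sub>0)"] by (simp add: le_max_iff_disj)
  also have "\<dots> = l * sqrt R / C" using C_pos R_pos by (simp add: l_def)
  finally show ?thesis .
qed

text \<open>The factor \<open>sqrt k\<close> in the second branch dominates \<open>sqrt R\<close>,
  which cancels the division by \<open>sqrt R\<close> in \<open>l\<close>.\<close>

lemma l0_le: "l\<^sub>0 \<le> l / C"
proof -
  have "sqrt R * l\<^sub>0 \<le> sqrt k * l\<^sub>0"
    using l\<^sub>0_nonneg by (intro mult_right_mono) (auto simp: k_def)
  also have "\<dots> \<le> max (sqrt s * D) (sqrt k * l\<^sub>0)" by simp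
  also have "\<dots> \<le> \<eta> * max (sqrt s * D) (sqrt k * l\<^sub>0)"
    using eta D_nonneg s_ge_1
      mult_right_mono[of 1 \<eta> "max (sqrt s * D) (sqrt k * l\<^sub>0)"] by (simp add: le_max_iff_disj)
  also have "\<dots> = sqrt R * (l / C)" using C_pos R_pos by (simp add: l_def)
  finally show ?thesis using R_pos by (simp only: mult_le_cancel_left_pos real_sqrt_gt_0_iff)
qed

text \<open>The bound on \<open>l1 I x\<close> contributes \<open>sqrt s\<close>, and
  \<open>D * sqrt s \<le> D * s \<le> r\<close> since \<open>s\<close> is at least 1.\<close>

lemma lin_dev_bound: "cm * D * l1 I x \<le> cm / sqrt (c * u) * r"
proof -
  have "cm * D * l1 I x \<le> cm * D * (sqrt s / (sqrt c * sqrt R))"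
    using l1_x pos D_nonneg by (intro mult_left_mono) auto
  also have "\<dots> = cm / sqrt c * (D * sqrt s) * (1 / sqrt R)" by simp
  also have "\<dots> \<le> cm / sqrt c * r * (1 / sqrt u)"
  proof (intro mult_mono mult_left_mono)
    have "sqrt s \<le> s" using s_ge_1 by (intro real_le_lsqrt) (auto simp: power2_eq_square)
    then have "D * sqrt s \<le> s * D" using D_nonneg by (simp add: mult_left_mono mult.commute)
    then show "D * sqrt s \<le> r" using sD_le by linarith
    show "1 / sqrt R \<le> 1 / sqrt u" using pos R_ge by (simp add: frac_le)
  qed (use pos r_nonneg R_pos D_nonneg s_ge_1 in auto)
  finally show ?thesis by (simp add: real_sqrt_mult mult_ac)
qed

lemma lin_dev_x: "\<bar>lin I m' x - 1\<bar> \<le> cm / sqrt (c * u) * r"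
  using lin_diff_bound[of I m' m "cm * D" x] dev_lin x_feasible lin_dev_bound by force

text \<open>For \<open>A \<eta>\<^sup>2 r \<ge> 1\<close> the claimed lower bound is not positive, hence trivial.\<close>

context
  assumes small: "A * \<eta>\<^sup>2 * r < 1" and l_pos: "0 < l"
begin

text \<open>The oracle meets the population constraint only. Dividing it by its sample value
  \<open>t\<close> repairs this and leaves its Rayleigh quotient unchanged by homogeneity.\<close>

definition "t = lin I m' x"
definition "\<tau> = 1 / t"
definition "z = (\<lambda>i. \<tau> * x i)"
definition "h = (\<lambda>i. y i - \<tau> * x i)"

text \<open>\<open>A\<close> is a sum of four nonnegative terms with weights 3, 9/4, 2 and 1, so
  each term times \<open>\<eta>\<^sup>2 * r\<close> is below the reciprocal of its weight. In the
  last two \<open>\<eta>\<^sup>2 \<ge> 1\<close> is dropped.\<close>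

lemma A_terms_small:
  "12 * cm * C / (a * sqrt u) * \<eta>\<^sup>2 * r \<le> 1/3" "15 * C\<^sup>2 / a * \<eta>\<^sup>2 * r \<le> 4/9"
  "cm / sqrt (c * u) * r \<le> 1/2" "32 * cq / a * r \<le> 1"
proof -
  let ?p = "12 * cm * C / (a * sqrt u)" and ?q = "15 * C\<^sup>2 / a"
    and ?v = "cm / sqrt (c * u)" and ?w = "32 * cq / a"
  have nn: "0 \<le> ?p" "0 \<le> ?q" "0 \<le> ?v" "0 \<le> ?w" using pos C_pos by auto
  have eta2: "1 \<le> \<eta>\<^sup>2" using eta by (simp add: one_le_power)
  then have r_le: "r \<le> \<eta>\<^sup>2 * r" using r_nonneg mult_right_mono[of 1 "\<eta>\<^sup>2" r] by simp
  let ?e = "\<eta>\<^sup>2 * r"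
  have e: "0 \<le> ?e" using r_nonneg by simp
  have linear_bounds: "P \<le> 1/3 \<and> Q \<le> 4/9 \<and> V \<le> 1/2 \<and> W \<le> 1"
    if "3 * P + 9/4 * Q + 2 * V + W < 1" "0 \<le> P" "0 \<le> Q" "0 \<le> V" "0 \<le> W" for P Q V W :: real
    using that by auto
  have "3 * (?p * ?e) + 9/4 * (?q * ?e) + 2 * (?v * ?e) + ?w * ?e < 1"
    using small unfolding A_def by (simp add: algebra_simps)
  moreover have "0 \<le> ?p * ?e" "0 \<le> ?q * ?e" "0 \<le> ?v * ?e" "0 \<le> ?w * ?e"
    using nn e by (simp_all only: mult_nonneg_nonneg)
  ultimately have *: "?p * ?e \<le> 1/3" "?q * ?e \<le> 4/9" "?v * ?e \<le> 1/2" "?w * ?e \<le> 1"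
    using linear_bounds by blast+
  show "?p * \<eta>\<^sup>2 * r \<le> 1/3" "?q * \<eta>\<^sup>2 * r \<le> 4/9" using *(1,2) by (simp_all add: mult.assoc)
  show "?v * r \<le> 1/2" "?w * r \<le> 1"
    using *(3,4) mult_left_mono[OF r_le nn(3)] mult_left_mono[OF r_le nn(4)] by linarith+
qed

text \<open>The sample value \<open>t\<close> lies within 1/2 of 1, and the reciprocal maps
  [1/2, 3/2] onto [2/3, 2].\<close>

lemma tau_bounds: "2/3 \<le> \<tau>" "\<tau> \<le> 2"
proof -
  have "\<bar>t - 1\<bar> \<le> 1/2" using lin_dev_x A_terms_small(3) unfolding t_def by linarith
  then have "1/2 \<le> t" "t \<le> 3/2" unfolding abs_le_iff by linarith+
  then show "2/3 \<le> \<tau>" "\<tau> \<le> 2" by (auto simp: \<tau>_def field_simps)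
qed

lemma y_eq: "y = (\<lambda>i. z i + 1 * h i)"
  by (simp add: z_def h_def)

lemma z_feasible: "lin I m' z = 1"
proof -
  \<comment> \<open>As \<open>1 / 0 = 0\<close>, the lower bound on \<tau> excludes
    \<open>t = 0\<close>.\<close>
  have "t \<noteq> 0" using tau_bounds by (auto simp: \<tau>_def)
  then show ?thesis unfolding z_def lin_scale t_def[symmetric] by (simp add: \<tau>_def)
qed

lemma h_feasible: "lin I m' h = 0"
  using y_feasible z_feasible by (subst (asm) y_eq) (simp only: lin_add_scale)

text \<open>The sample functional vanishes at \<open>h\<close>, so its population value is pure
  perturbation.\<close>

lemma lin_h: "\<bar>lin I m h\<bar> \<le> cm * D * l1 I h"
  using lin_diff_bound[of I m' m "cm * D" h] dev_lin h_feasible by simp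

section \<open>Deviation of the estimate from the rescaled oracle\<close>

lemma cross_population: "\<bar>2 * bil I Q z h\<bar> \<le> l / C * (4 * cm / sqrt u + 3) * l1 I h"
proof -
  define \<nu> where "\<nu> = lin I m h"
  \<comment> \<open>\<open>h\<close> is tangent to the sample constraint; since
    \<open>lin I m x = 1\<close>, subtracting \<open>\<nu> * x\<close> makes it tangent to the
    population constraint, where stationarity of \<open>x\<close> applies.\<close>
  let ?w = "\<lambda>i. h i + (- \<nu>) * x i"
  have "lin I m ?w = 0" by (simp add: lin_add_scale x_feasible \<nu>_def del: mult_minus_left)
  then have "\<bar>2 * bil I Q x ?w\<bar> \<le> l\<^sub>0 * l1 I ?w"
    using sym l\<^sub>0_nonneg x_feasible x_optimal by (intro penalized_minimizer_stationary) auto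
  also have "\<dots> \<le> l\<^sub>0 * (l1 I h + \<bar>\<nu>\<bar> * l1 I x)"
    using l1_add_scale[of I h "- \<nu>" x] l\<^sub>0_nonneg by (intro mult_left_mono) auto
  also have "bil I Q x ?w = bil I Q x h - \<nu> / R" by (simp only: bil_add_scale_right bil_x) simp
  finally have "\<bar>2 * bil I Q x h - 2 * (\<nu> / R)\<bar> \<le> l\<^sub>0 * (l1 I h + \<bar>\<nu>\<bar> * l1 I x)" by simp
  then have 1: "\<bar>2 * bil I Q x h\<bar> \<le> 2 * (\<bar>\<nu>\<bar> / R) + l\<^sub>0 * l1 I h + l\<^sub>0 * (\<bar>\<nu>\<bar> * l1 I x)"
    using abs_triangle_ineq[of "2 * bil I Q x h - 2 * (\<nu> / R)" "2 * (\<nu> / R)"] R_pos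
    by (simp add: abs_mult distrib_left)
  have 2: "\<bar>\<nu>\<bar> / R \<le> l / C * (cm / sqrt u) * l1 I h"
  proof -
    have "\<bar>\<nu>\<bar> / R \<le> cm * D * l1 I h / R"
      using lin_h R_pos by (simp add: \<nu>_def divide_right_mono)
    also have "D \<le> l * sqrt R / C"
      using D_le D_nonneg s_ge_1 mult_left_mono[of 1 "sqrt s" D] by simp
    then have "cm * D * l1 I h / R \<le> cm * (l * sqrt R / C) * l1 I h / R"
      using pos R_pos by (intro divide_right_mono mult_right_mono mult_left_mono) auto
    also have "\<dots> = l / C * l1 I h * cm * (1 / sqrt R)"
    proof -
      have "sqrt R / R = 1 / sqrt R" using R_pos by (simp add: field_simps)
      then have "cm * l / C * l1 I h * (sqrt R / R) = cm * l / C * l1 I h * (1 / sqrt R)" by simp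
      then show ?thesis by (simp add: mult_ac)
    qed
    also have "\<dots> \<le> l / C * l1 I h * cm * (1 / sqrt u)"
      using pos R_ge l_nonneg C_pos by (intro mult_left_mono frac_le) auto
    finally show ?thesis by (simp add: mult_ac)
  qed
  have 3: "l\<^sub>0 * l1 I h \<le> l / C * l1 I h" by (rule mult_right_mono[OF l0_le l1_nonneg])
  have 4: "l\<^sub>0 * (\<bar>\<nu>\<bar> * l1 I x) \<le> l / C * (l1 I h * (1/2))"
  proof (rule mult_mono)
    have "cm * D * l1 I x \<le> 1/2" 
    proof -
      have "cm * D * l1 I x \<le> cm / sqrt (c * u) * r" by (rule lin_dev_bound)
      then show ?thesis using A_terms_small(3) by linarith
    qed
    then have "l1 I h * (cm * D * l1 I x) \<le> l1 I h * (1/2)" by (intro mult_left_mono) auto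
    moreover have "\<bar>\<nu>\<bar> * l1 I x \<le> cm * D * l1 I h * l1 I x"
      using lin_h by (simp add: \<nu>_def mult_right_mono)
    ultimately show "\<bar>\<nu>\<bar> * l1 I x \<le> l1 I h * (1/2)" by (simp add: mult_ac)
  qed (use l0_le l_nonneg C_pos in auto)
  \<comment> \<open>The tangency correction contributes \<open>2 * cm / sqrt u\<close>, the penalty
    of \<open>h\<close> contributes 1 and the penalty of the correction 1/2. Passing from
    \<open>x\<close> to \<open>z\<close> multiplies by \<open>\<tau> \<le> 2\<close>.\<close>
  have "\<bar>2 * bil I Q x h\<bar> \<le> l / C * (2 * cm / sqrt u + 3/2) * l1 I h"
    using 1 2 3 4 by (simp add: algebra_simps)
  then have "\<tau> * \<bar>2 * bil I Q x h\<bar> \<le> 2 * (l / C * (2 * cm / sqrt u + 3/2) * l1 I h)"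
    using tau_bounds by (intro mult_mono) auto
  moreover have "\<bar>2 * bil I Q z h\<bar> = \<tau> * \<bar>2 * bil I Q x h\<bar>"
    unfolding z_def bil_scale using tau_bounds by (simp add: abs_mult)
  ultimately show ?thesis by (simp add: algebra_simps)
qed

lemma cross_population_half: "\<bar>2 * bil I Q z h\<bar> \<le> l / 2 * l1 I h"
proof -
  have "l / C * (4 * cm / sqrt u + 3) \<le> l / C * (C / 2)"
    using l_nonneg C_pos pos by (intro mult_left_mono) (auto simp: C_def)
  then have "l / C * (4 * cm / sqrt u + 3) * l1 I h \<le> l / 2 * l1 I h"
    using C_pos by (intro mult_right_mono) auto
  then show ?thesis using cross_population by linarith
qed

text \<open>Replacing \<open>Q\<close> by \<open>Q'\<close> costs
  \<open>cq * D * l1 I z * l1 I h\<close>, and \<open>l1 I z\<close> is at most twice the bound on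
  \<open>l1 I x\<close>. The summand \<open>4 * cq / sqrt c\<close> of \<open>C\<close> pays for
  this, so that the whole cross term is still at most half of the penalty of
  \<open>h\<close>.\<close>

lemma cross_sample_half: "\<bar>2 * bil I Q' z h\<bar> \<le> l / 2 * l1 I h"
proof -
  have "\<bar>bil I Q' z h - bil I Q z h\<bar> \<le> cq * D * l1 I z * l1 I h"
    by (rule bil_diff_bound) (use dev_bil in auto)
  also have "\<dots> \<le> l / C * (2 * cq / sqrt c) * l1 I h"
  proof (rule mult_right_mono)
    have "l1 I z = \<tau> * l1 I x" unfolding z_def l1_scale using tau_bounds by simp
    also have "\<dots> \<le> 2 * (sqrt s / (sqrt c * sqrt R))"
      using tau_bounds l1_x by (intro mult_mono) auto
    finally have "cq * D * l1 I z \<le> cq * D * (2 * (sqrt s / (sqrt c * sqrt R)))"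
      using pos D_nonneg by (intro mult_left_mono) auto
    also have "\<dots> = 2 * cq / sqrt c * (D * sqrt s / sqrt R)" by simp
    also have "\<dots> \<le> 2 * cq / sqrt c * (l / C)"
      using D_le R_pos pos by (intro mult_left_mono) (auto simp: divide_le_eq)
    finally show "cq * D * l1 I z \<le> l / C * (2 * cq / sqrt c)" by (simp add: mult_ac)
  qed simp
  finally have "\<bar>bil I Q' z h - bil I Q z h\<bar> \<le> l / C * (2 * cq / sqrt c) * l1 I h" .
  moreover have "\<bar>2 * p\<bar> \<le> \<bar>2 * q\<bar> + 2 * \<bar>p - q\<bar>" for p q :: real by (simp add: abs_if)
  ultimately have "\<bar>2 * bil I Q' z h\<bar>
      \<le> l / C * (4 * cm / sqrt u + 3) * l1 I h + 2 * (l / C * (2 * cq / sqrt c) * l1 I h)"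
    using cross_population by (meson add_mono mult_left_mono order_trans zero_le_numeral)
  also have "\<dots> = l / C * (4 * cm / sqrt u + 3 + 2 * (2 * cq / sqrt c)) * l1 I h"
    by (simp only: distrib_left distrib_right mult_ac)
  also have "4 * cm / sqrt u + 3 + 2 * (2 * cq / sqrt c) = C / 2" by (simp add: C_def)
  finally show ?thesis using C_pos by simp
qed

lemma bil_y: "bil I Q y y = \<tau>\<^sup>2 / R + 2 * bil I Q z h + bil I Q h h"
proof -
  have "bil I Q y y = bil I Q z z + 2 * 1 * bil I Q z h + 1\<^sup>2 * bil I Q h h"
    by (subst y_eq, subst (2) y_eq) (rule bil_square_add_scale, use sym in auto)
  also have "bil I Q z z = \<tau>\<^sup>2 / R"
    by (simp add: z_def bil_scale bil_x power2_eq_square)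
  finally show ?thesis by simp
qed

text \<open>Optimality of \<open>y\<close> against the feasible \<open>z\<close> in the sample
  problem, with the quadratic form expanded around \<open>z\<close>, is the hypothesis of
  \<open>cone_basic_inequality\<close>; \<open>z\<close> has the support of the oracle, and
  \<open>cross_sample_half\<close> controls the cross term.\<close>

lemma deviation_cone:
  "l1 (I - S) h \<le> 3 * l1 S h" "bil I Q' h h \<le> 3/2 * l * l1 S h"
proof -
  have "bil I Q' y y = bil I Q' z z + 2 * 1 * bil I Q' z h + 1\<^sup>2 * bil I Q' h h"
    by (subst y_eq, subst (2) y_eq) (rule bil_square_add_scale, use sym' in auto)
  moreover have "bil I Q' y y + l * l1 I y \<le> bil I Q' z z + l * l1 I z"
    by (rule y_optimal[OF z_feasible])
  moreover have "y = (\<lambda>i. z i + h i)" using y_eq by simp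
  ultimately have "bil I Q' h h + 2 * bil I Q' z h + l * l1 I (\<lambda>i. z i + h i) \<le> l * l1 I z"
    by simp
  moreover have "z i = 0" if "i \<in> I - S" for i using that x_support by (simp add: z_def)
  moreover have "- (l / 2 * l1 I h) \<le> 2 * bil I Q' z h" using cross_sample_half by linarith
  ultimately show "l1 (I - S) h \<le> 3 * l1 S h" "bil I Q' h h \<le> 3/2 * l * l1 S h"
    using cone_basic_inequality[OF fin S_subset _ l_pos psd'] by blast+
qed

text \<open>On the cone the perturbation of the form is absorbed by half of the form itself, giving
  \<open>q \<le> 3 * l * p\<close>. The restricted eigenvalue bounds \<open>p\<^sup>2\<close> by
  \<open>s * q / a\<close>; combining the two closes the loop.\<close>

lemma deviation_bounds: "bil I Q h h \<le> 9 * (l\<^sup>2 * s) / a" "l1 I h \<le> 12 * (l * s) / a"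
proof -
  define q p where "q = bil I Q h h" and "p = l1 S h"
  have pp: "0 \<le> p" and q: "0 \<le> q" by (simp_all add: p_def q_def psd)
  have h4: "l1 I h \<le> 4 * p"
    using l1_split[OF fin S_subset, of h] deviation_cone(1) by (simp add: p_def)
  have p2: "p\<^sup>2 \<le> s * q / a"
    unfolding p_def q_def by (rule l1_le[OF cone_3 pos(1) deviation_cone(1)])
  have "\<bar>bil I Q' h h - q\<bar> \<le> cq * D * l1 I h * l1 I h"
    unfolding q_def by (rule bil_diff_bound) (use dev_bil in auto)
  \<comment> \<open>The cone condition gives \<open>l1 I h \<le> (1 + 3) * p\<close>; the resulting
    16 explains the summand \<open>32 * cq / a\<close> of \<open>A\<close>, chosen so that the error
    ends up below \<open>q / 2\<close>.\<close>
  also have "\<dots> \<le> cq * D * (4 * p) * (4 * p)"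
    using h4 pp pos D_nonneg by (intro mult_mono mult_nonneg_nonneg) auto
  also have "\<dots> = 16 * cq * D * p\<^sup>2" by (simp add: power2_eq_square)
  also have "\<dots> \<le> 16 * cq * D * (s * q / a)"
    using p2 pos D_nonneg by (intro mult_left_mono) auto
  also have "\<dots> = 16 * cq / a * q * (s * D)" by simp
  also have "\<dots> \<le> 16 * cq / a * q * r"
    using sD_le pos q by (intro mult_left_mono) auto
  also have "\<dots> = 32 * cq / a * r * (q / 2)" by simp
  also have "\<dots> \<le> 1 * (q / 2)"
    using A_terms_small(4) q by (intro mult_right_mono) auto
  finally have "- (bil I Q' h h - q) \<le> 1 * (q / 2)" by (rule abs_le_D2)
  then have q_le: "q \<le> 3 * l * p" using deviation_cone(2) by (simp add: p_def)
  then have "q\<^sup>2 \<le> (3 * l * p)\<^sup>2" using q by (intro power_mono) auto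
  also have "\<dots> = 9 * l\<^sup>2 * p\<^sup>2" by (simp add: power_mult_distrib)
  also have "\<dots> \<le> 9 * l\<^sup>2 * (s * q / a)" using p2 by (intro mult_left_mono) auto
  also have "\<dots> = 9 * (l\<^sup>2 * s) / a * q" by simp
  \<comment> \<open>One factor \<open>q\<close> cancels, and the case \<open>q = 0\<close> is
    trivial.\<close>
  finally have "q * q \<le> 9 * (l\<^sup>2 * s) / a * q" by (simp add: power2_eq_square)
  moreover have nn: "0 \<le> 9 * (l\<^sup>2 * s) / a" using pos s_ge_1 by simp
  ultimately have q9: "q \<le> 9 * (l\<^sup>2 * s) / a"
    using q mult_right_le_imp_le[of q q "9 * (l\<^sup>2 * s) / a"] by (cases "q = 0") auto
  then show "bil I Q h h \<le> 9 * (l\<^sup>2 * s) / a" by (simp add: q_def)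
  have "p\<^sup>2 \<le> s * (9 * (l\<^sup>2 * s) / a) / a"
    using p2 q9 pos s_ge_1 by (elim order_trans) (intro divide_right_mono mult_left_mono, auto)
  also have "\<dots> = (3 * (l * s) / a)\<^sup>2" by (simp add: power2_eq_square)
  finally have "p \<le> 3 * (l * s) / a"
    using pos s_ge_1 l_nonneg by (elim power2_le_imp_le) simp
  then show "l1 I h \<le> 12 * (l * s) / a" using h4 by simp
qed

section \<open>Numerator and denominator of the Rayleigh quotient at the estimate\<close>

text \<open>The square of \<open>l_sqrt_s\<close> is quadratic in \<open>r\<close>;
  \<open>r < 1\<close> makes it linear, matching the rate in the final bound.\<close>

lemma l_squared_s: "l\<^sup>2 * s \<le> C\<^sup>2 * (\<eta>\<^sup>2 * r) / R"
proof -
  have "l\<^sup>2 * s = (l * sqrt s)\<^sup>2" using s_ge_1 by (simp add: power_mult_distrib)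
  also have "\<dots> = C\<^sup>2 * (\<eta>\<^sup>2 * r\<^sup>2) / R"
    using R_pos by (simp add: l_sqrt_s power_mult_distrib power_divide)
  also have "r\<^sup>2 \<le> r" using r_nonneg r_less by (simp add: power2_eq_square mult_left_le)
  then have "C\<^sup>2 * (\<eta>\<^sup>2 * r\<^sup>2) / R \<le> C\<^sup>2 * (\<eta>\<^sup>2 * r) / R"
    using R_pos by (intro divide_right_mono mult_left_mono) auto
  finally show ?thesis .
qed

text \<open>The population value at \<open>z\<close> is \<tau>, and the value at \<open>h\<close> is
  bounded by \<open>D * l1 I h\<close>. Of the two factors \<open>sqrt s\<close> in
  \<open>l1 I h\<close>, one turns \<open>l\<close> into \<open>r\<close> and the other is absorbed
  by \<open>D * sqrt s \<le> 1\<close>.\<close>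

lemma lin_y: "\<tau> - 12 * cm * C / (a * sqrt u) * \<eta>\<^sup>2 * r \<le> lin I m y"
proof -
  have "\<bar>lin I m h\<bar> \<le> cm * D * (12 * (l * s) / a)"
    using lin_h deviation_bounds(2) pos D_nonneg
    by (elim order_trans) (intro mult_left_mono, auto)
  also have "l * s = C * \<eta> * r / sqrt R * sqrt s"
    using s_ge_1 by (simp flip: l_sqrt_s)
  also have "cm * D * (12 * (C * \<eta> * r / sqrt R * sqrt s) / a)
      = 12 * cm * C / a * \<eta> * r * (D * sqrt s) * (1 / sqrt R)"
    by (simp add: mult_ac)
  also have "\<dots> \<le> 12 * cm * C / a * \<eta>\<^sup>2 * r * 1 * (1 / sqrt u)"
  proof (intro mult_mono)
    have "sqrt s \<le> s" using s_ge_1 by (intro real_le_lsqrt) (auto simp: power2_eq_square)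
    then have "D * sqrt s \<le> s * D" using D_nonneg by (simp add: mult_left_mono mult.commute)
    then show "D * sqrt s \<le> 1" using sD_le r_less by linarith
    show "1 / sqrt R \<le> 1 / sqrt u" using pos R_ge by (simp add: frac_le)
    show "\<eta> \<le> \<eta>\<^sup>2" using eta by (simp add: power2_eq_square)
  qed (use pos r_nonneg R_pos C_pos eta D_nonneg s_ge_1 in auto)
  finally have "\<bar>lin I m h\<bar> \<le> 12 * cm * C / (a * sqrt u) * \<eta>\<^sup>2 * r" by simp
  moreover have "lin I m y = \<tau> + lin I m h"
    using lin_add_scale[of I m z 1 h] lin_scale[of I m \<tau> x] x_feasible y_eq z_def by simp
  ultimately show ?thesis by linarith
qed

text \<open>In the expansion of the form at \<open>z + h\<close> the cross term contributes
  \<open>6 * B\<close> and the form at \<open>h\<close> contributes \<open>9 * B\<close>, which add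
  up to 15.\<close>

lemma bil_y_bounds:
  "bil I Q y y * R \<le> \<tau>\<^sup>2 + 15 * C\<^sup>2 / a * \<eta>\<^sup>2 * r" "0 < bil I Q y y * R"
proof -
  define B where "B = C\<^sup>2 * (\<eta>\<^sup>2 * r) / (R * a)"
  have lB: "l\<^sup>2 * s / a \<le> B"
    using divide_right_mono[OF l_squared_s, of a] pos by (simp add: B_def)
  have "l / 2 * l1 I h \<le> l / 2 * (12 * (l * s) / a)"
    using deviation_bounds(2) l_nonneg by (intro mult_left_mono) auto
  also have "\<dots> = 6 * (l\<^sup>2 * s / a)" by (simp add: power2_eq_square)
  finally have cross: "\<bar>2 * bil I Q z h\<bar> \<le> 6 * B" using cross_population_half lB by linarith
  have BR: "B * R = C\<^sup>2 / a * \<eta>\<^sup>2 * r" using R_pos by (simp add: B_def)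
  have "bil I Q y y \<le> \<tau>\<^sup>2 / R + 15 * B" using bil_y cross deviation_bounds(1) lB by simp
  then have "bil I Q y y * R \<le> (\<tau>\<^sup>2 / R + 15 * B) * R" using R_pos by (intro mult_right_mono) auto
  also have "\<dots> = \<tau>\<^sup>2 + 15 * (B * R)" using R_pos by (simp add: algebra_simps)
  finally show "bil I Q y y * R \<le> \<tau>\<^sup>2 + 15 * C\<^sup>2 / a * \<eta>\<^sup>2 * r" by (simp add: BR)
  \<comment> \<open>From below only the cross term can hurt. Smallness of
    \<open>A * \<eta>\<^sup>2 * r\<close> gives
    \<open>15 * (B * R) \<le> 4/9 \<le> \<tau>\<^sup>2\<close>, so \<open>6 * (B * R)\<close> does
    not exhaust \<open>\<tau>\<^sup>2\<close>.\<close>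
  have "\<tau>\<^sup>2 / R - 6 * B \<le> bil I Q y y" using bil_y cross psd[of h] by linarith
  then have "(\<tau>\<^sup>2 / R - 6 * B) * R \<le> bil I Q y y * R"
    using R_pos by (intro mult_right_mono) auto
  moreover have "(\<tau>\<^sup>2 / R - 6 * B) * R = \<tau>\<^sup>2 - 6 * (B * R)"
    using R_pos by (simp add: algebra_simps)
  moreover have "15 * (B * R) \<le> 4/9" using A_terms_small(2) by (simp add: BR)
  moreover have "4/9 \<le> \<tau>\<^sup>2" using power_mono[OF tau_bounds(1), of 2] by (simp add: power2_eq_square)
  ultimately show "0 < bil I Q y y * R" by linarith
qed

lemma ratio_bound_small: "1 - A * \<eta>\<^sup>2 * r \<le> (lin I m y)\<^sup>2 / (bil I Q y y * R)"
proof -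
  let ?e1 = "12 * cm * C / (a * sqrt u) * \<eta>\<^sup>2 * r" and ?e2 = "15 * C\<^sup>2 / a * \<eta>\<^sup>2 * r"
  have "1 - (3 * ?e1 + 9/4 * ?e2) \<le> (lin I m y)\<^sup>2 / (bil I Q y y * R)"
  proof (rule rayleigh_ratio_lower_bound[OF tau_bounds(1) _ _ _ lin_y bil_y_bounds(2,1)])
    show "?e1 \<le> \<tau>" using A_terms_small(1) tau_bounds(1) by linarith
  qed (use pos C_pos r_nonneg in auto)
  moreover have "3 * ?e1 + 9/4 * ?e2 \<le> A * \<eta>\<^sup>2 * r"
  proof -
    have "(3 * (12 * cm * C / (a * sqrt u)) + 9/4 * (15 * C\<^sup>2 / a)) * (\<eta>\<^sup>2 * r) \<le> A * (\<eta>\<^sup>2 * r)"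
      using pos r_nonneg by (intro mult_right_mono) (auto simp: A_def)
    then show ?thesis by (simp add: algebra_simps)
  qed
  ultimately show ?thesis by linarith
qed

end

text \<open>The cone argument divides by \<open>l\<close>, so \<open>l = 0\<close> is separate. It
  forces \<open>D = 0\<close> and \<open>l\<^sub>0 = 0\<close>; the sample and population problems
  then coincide without penalty, and \<open>x\<close> and \<open>y\<close> both minimize the same
  form.\<close>

lemma ratio_bound_zero_penalty:
  assumes "l = 0"
  shows "1 \<le> (lin I m y)\<^sup>2 / (bil I Q y y * R)"
proof -
  have "D = 0" using D_le D_nonneg s_ge_1 assms mult_left_mono[of 1 "sqrt s" D] by simp
  have "l\<^sub>0 = 0" using l0_le l\<^sub>0_nonneg assms by simp
  have "\<bar>lin I m' v - lin I m v\<bar> \<le> 0" for v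
    using lin_diff_bound[of I m' m "cm * D" v] dev_lin \<open>D = 0\<close> by simp
  then have ly: "lin I m y = 1" "lin I m' x = 1" using y_feasible x_feasible by simp_all
  have "\<bar>bil I Q' v v - bil I Q v v\<bar> \<le> 0" for v
    using bil_diff_bound[of I Q' Q "cq * D" v v] dev_bil \<open>D = 0\<close> by simp
  then have eq: "bil I Q' v v = bil I Q v v" for v by simp
  have "bil I Q y y = 1 / R"
    using x_optimal[OF ly(1)] y_optimal[OF ly(2)] assms \<open>l\<^sub>0 = 0\<close> bil_x by (simp add: eq)
  then show ?thesis using R_pos ly by simp
qed

theorem ratio_bound: "1 - A * \<eta>\<^sup>2 * r \<le> (lin I m y)\<^sup>2 / (bil I Q y y * R)"
proof (cases "A * \<eta>\<^sup>2 * r < 1")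
  case True
  have "0 < A" using pos C_pos unfolding A_def by (intro add_pos_pos) auto
  then have "0 \<le> A * \<eta>\<^sup>2 * r" using r_nonneg by simp
  then show ?thesis
    using ratio_bound_small[OF True] ratio_bound_zero_penalty l_nonneg by (cases "l = 0") auto
next
  case False
  moreover have "0 \<le> (lin I m y)\<^sup>2 / (bil I Q y y * R)" using psd R_pos by simp
  ultimately show ?thesis by linarith
qed

end

section \<open>Stacked coordinates\<close>

text \<open>
  The induction eliminates one index at a time by passing to the Schur complement of a diagonal entry.
\<close>

lemma trace_product_nonneg:
  fixes A B :: "'i \<Rightarrow> 'i \<Rightarrow> real"
  assumes "finite I"
    and "\<And>i j. i \<in> I \<Longrightarrow> j \<in> I \<Longrightarrow> A i j = A j i" "\<And>v. 0 \<le> bil I A v v"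
    and "\<And>v. 0 \<le> bil I B v v"
  shows "0 \<le> (\<Sum>i\<in>I. \<Sum>j\<in>I. A i j * B i j)"
  using assms
proof (induction I arbitrary: A rule: finite_induct)
  case empty
  then show ?case by simp
next
  case (insert k I)
  let ?J = "insert k I"
  have symA: "A i j = A j i" if "i \<in> ?J" "j \<in> ?J" for i j using insert.prems(1) that by blast
  have bil_insert: "bil ?J F v v = v k * F k k * v k + (\<Sum>i\<in>I. v k * F k i * v i)
      + (\<Sum>i\<in>I. v i * F i k * v k) + bil I F v v" for F :: "'i \<Rightarrow> 'i \<Rightarrow> real" and v
    using insert.hyps by (simp add: bil_def sum.distrib)
  have restrict: "bil ?J F (v(k := 0)) (v(k := 0)) = bil I F v v" for F :: "'i \<Rightarrow> 'i \<Rightarrow> real" and v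
  proof -
    have "bil I F (v(k := 0)) (v(k := 0)) = bil I F v v"
      unfolding bil_def using insert.hyps by (intro sum.cong refl) auto
    then show ?thesis by (simp add: bil_insert)
  qed
  have psdA: "0 \<le> bil I A v v" for v using insert.prems(2) restrict[of A v] by metis
  have psdB: "0 \<le> bil I B v v" for v using insert.prems(3) restrict[of B v] by metis
  \<comment> \<open>Evaluated at the vector with entry \<open>x\<close> at \<open>k\<close> and
    \<open>v\<close> on \<open>I\<close>; the point is to minimize over \<open>x\<close>.\<close>
  have quad: "0 \<le> x\<^sup>2 * A k k + 2 * x * (\<Sum>i\<in>I. A k i * v i) + bil I A v v" for x v
  proof -
    define w where "w = v(k := x)"
    have w: "w k = x" "\<And>i. i \<in> I \<Longrightarrow> w i = v i" using insert.hyps by (auto simp: w_def)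
    have "bil I A w w = bil I A v v"
      unfolding bil_def by (intro sum.cong refl) (simp add: w)
    moreover have "(\<Sum>i\<in>I. x * A k i * w i) = x * (\<Sum>i\<in>I. A k i * v i)"
      unfolding sum_distrib_left by (intro sum.cong) (auto simp: w)
    moreover have "(\<Sum>i\<in>I. w i * A i k * x) = x * (\<Sum>i\<in>I. A k i * v i)"
      unfolding sum_distrib_left using symA by (intro sum.cong) (auto simp: w)
    moreover have "0 \<le> x * A k k * x + (\<Sum>i\<in>I. x * A k i * w i)
        + (\<Sum>i\<in>I. w i * A i k * x) + bil I A w w"
      using insert.prems(2)[of w] unfolding bil_insert w(1) .
    ultimately show ?thesis by (simp add: power2_eq_square mult_ac)
  qed
  show ?case
  proof (cases "A k k = 0")
    case True
    \<comment> \<open>With \<open>A k k = 0\<close> a nonzero entry in the row would make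
      \<open>quad\<close> unbounded below in \<open>x\<close>. Choosing
      \<open>x = - A k i / (2 * e)\<close> and multiplying by \<open>e\<^sup>2\<close> gives the
      form required by \<open>nonneg_linear_coeff\<close>.\<close>
    have row: "A k i = 0" if "i \<in> I" for i
    proof -
      let ?v = "\<lambda>j. if j = i then 1 else 0 :: real"
      have s: "(\<Sum>j\<in>I. A k j * ?v j) = A k i" using that insert.hyps
        by (simp add: if_distrib[of "\<lambda>x. _ * x"] cong: if_cong)
      have "0 \<le> - (A k i)\<^sup>2"
      proof (rule nonneg_linear_coeff)
        fix e :: real assume "e > 0"
        show "0 \<le> e * - (A k i)\<^sup>2 + e\<^sup>2 * bil I A ?v ?v"
        proof -
          have "0 \<le> 2 * (- A k i / (2 * e)) * A k i + bil I A ?v ?v"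
            using quad[of "- A k i / (2 * e)" ?v] True s by simp
          then have "0 \<le> e\<^sup>2 * (2 * (- A k i / (2 * e)) * A k i + bil I A ?v ?v)" by simp
          then show ?thesis using \<open>e > 0\<close> by (simp add: algebra_simps power2_eq_square)
        qed
      qed
      then show ?thesis by simp
    qed
    have "(\<Sum>i\<in>?J. \<Sum>j\<in>?J. A i j * B i j) = (\<Sum>i\<in>I. \<Sum>j\<in>I. A i j * B i j)"
      using insert.hyps True row symA by simp
    also have "0 \<le> \<dots>" using symA psdA psdB by (intro insert.IH) auto
    finally show ?thesis .
  next
    case False
    have "0 \<le> A k k" using quad[of 1 "\<lambda>_. 0"] by (simp add: bil_def)
    with False have pos: "0 < A k k" by simp
    \<comment> \<open>Schur complement of \<open>A k k\<close>. Its row and column \<open>k\<close>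
      vanish, so its sums over \<open>I\<close> and \<open>?J\<close> agree, and its form at
      \<open>v\<close> is the minimum of \<open>quad\<close> over \<open>x\<close>, attained at
      \<open>- \<sigma> / A k k\<close>.\<close>
    define A' where "A' i j = A i j - A k i * A k j / A k k" for i j
    have "0 \<le> (\<Sum>i\<in>I. \<Sum>j\<in>I. A' i j * B i j)"
    proof (rule insert.IH)
      show "A' i j = A' j i" if "i \<in> I" "j \<in> I" for i j using symA that by (simp add: A'_def)
      show "0 \<le> bil I A' v v" for v
      proof -
        define \<sigma> where "\<sigma> = (\<Sum>i\<in>I. A k i * v i)"
        have "bil I A' v v = bil I A v v - (\<Sum>i\<in>I. \<Sum>j\<in>I. (A k i * v i) * (A k j * v j)) / A k k"
          by (simp add: bil_def A'_def algebra_simps sum_subtractf sum_divide_distrib diff_divide_distrib)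
        also have "(\<Sum>i\<in>I. \<Sum>j\<in>I. (A k i * v i) * (A k j * v j)) = \<sigma>\<^sup>2"
          by (simp add: \<sigma>_def power2_eq_square sum_product)
        finally show ?thesis using quad[of "- \<sigma> / A k k" v] pos
          by (simp add: \<sigma>_def[symmetric] power2_eq_square)
      qed
    qed (rule psdB)
    also have "\<dots> = (\<Sum>i\<in>?J. \<Sum>j\<in>?J. A' i j * B i j)"
      using insert.hyps pos symA by (simp add: A'_def)
    \<comment> \<open>The removed rank-one part pairs with \<open>B\<close> to the form of
      \<open>B\<close> at row \<open>k\<close> of \<open>A\<close>, which is nonnegative.\<close>
    also have "\<dots> = (\<Sum>i\<in>?J. \<Sum>j\<in>?J. A i j * B i j) - bil ?J B (A k) (A k) / A k k"
      by (simp only: A'_def bil_def left_diff_distrib sum_subtractf sum_divide_distrib)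
         (simp add: mult_ac)
    finally have "bil ?J B (A k) (A k) / A k k \<le> (\<Sum>i\<in>?J. \<Sum>j\<in>?J. A i j * B i j)" by simp
    moreover have "0 \<le> bil ?J B (A k) (A k) / A k k" using insert.prems(3) pos by simp
    ultimately show ?thesis by linarith
  qed
qed

section \<open>Column stacking and M as a linear functional\<close>

lemma sum_lessThan_add:
  fixes f :: "nat \<Rightarrow> 'a :: comm_monoid_add"
  shows "(\<Sum>i<m + n. f i) = (\<Sum>i<m. f i) + (\<Sum>i<n. f (m + i))"
  by (induction n) (simp_all add: add.assoc)

lemma sum_stack:
  fixes f :: "nat \<Rightarrow> 'a :: comm_monoid_add"
  shows "(\<Sum>i<d * d + d. f i) = (\<Sum>c<d. \<Sum>r<d. f (c * d + r)) + (\<Sum>r<d. f (d * d + r))"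
proof -
  have "(\<Sum>i<n * d. f i) = (\<Sum>c<n. \<Sum>r<d. f (c * d + r))" for n
    by (induction n) (simp_all add: sum_lessThan_add add.commute[of d])
  then show ?thesis by (simp add: sum_lessThan_add)
qed

text \<open>Inverse of \<open>vec_stack\<close> on index functions, the type of vectors in the
  abstract comparison; only the values at indices below \<open>d * d\<close> matter.\<close>

definition unstack_mat :: "nat \<Rightarrow> (nat \<Rightarrow> real) \<Rightarrow> real mat" where
  "unstack_mat d v = mat d d (\<lambda>(r, c). v (c * d + r))"

definition unstack_vec :: "nat \<Rightarrow> (nat \<Rightarrow> real) \<Rightarrow> real vec" where
  "unstack_vec d v = vec d (\<lambda>i. v (d * d + i))"

lemma stack_index_less: "c < d \<Longrightarrow> r < d \<Longrightarrow> c * d + r < d * (d::nat)"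
proof -
  assume "c < d" "r < d"
  then have "c * d + r < Suc c * d" by simp
  also have "\<dots> \<le> d * d" using \<open>c < d\<close> by (intro mult_le_mono1) simp
  finally show ?thesis .
qed

lemma unstack_stack:
  assumes "\<Omega> \<in> carrier_mat d d" "\<delta> \<in> carrier_vec d"
  shows "unstack_mat d (\<lambda>i. (vec_stack \<Omega> @\<^sub>v \<delta>) $ i) = \<Omega>"
    "unstack_vec d (\<lambda>i. (vec_stack \<Omega> @\<^sub>v \<delta>) $ i) = \<delta>"
  using assms stack_index_less[of _ d]
  by (auto simp: trans_less_add1 unstack_mat_def unstack_vec_def vec_stack_def intro!: eq_matI eq_vecI)

lemma l1_unstack: "mat_l1 (unstack_mat d v) + vec_l1 (unstack_vec d v) = l1 {..<d * d + d} v"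
proof -
  have "mat_l1 (unstack_mat d v) = (\<Sum>r<d. \<Sum>c<d. \<bar>v (c * d + r)\<bar>)"
    by (simp add: mat_l1_def unstack_mat_def)
  also have "\<dots> = (\<Sum>c<d. \<Sum>r<d. \<bar>v (c * d + r)\<bar>)" by (rule sum.swap)
  finally show ?thesis by (simp add: l1_def sum_stack vec_l1_def unstack_vec_def)
qed

text \<open>The gradient of M in stacked coordinates: for \<open>i = c * d + r\<close> it is the
  derivative in the entry \<open>(r, c)\<close> of \<Omega>. The covariances appear at
  \<open>(c, r)\<close> because of the trace of a product.\<close>

definition lin_coeff :: "nat \<Rightarrow> real vec \<Rightarrow> real vec \<Rightarrow> real mat \<Rightarrow> real mat \<Rightarrow> nat \<Rightarrow> real" where
  "lin_coeff d \<mu>\<^sub>1 \<mu>\<^sub>2 \<Sigma>\<^sub>1 \<Sigma>\<^sub>2 i = (if i < d * d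
     then \<mu>\<^sub>2 $ (i mod d) * \<mu>\<^sub>2 $ (i div d) - \<mu>\<^sub>1 $ (i mod d) * \<mu>\<^sub>1 $ (i div d)
       - (\<Sigma>\<^sub>1 $$ (i div d, i mod d) - \<Sigma>\<^sub>2 $$ (i div d, i mod d))
     else 2 * (\<mu>\<^sub>1 $ (i - d * d) - \<mu>\<^sub>2 $ (i - d * d)))"

lemma quadro_M_unstack:
  assumes "\<mu>\<^sub>1 \<in> carrier_vec d" "\<mu>\<^sub>2 \<in> carrier_vec d" "\<Sigma>\<^sub>1 \<in> carrier_mat d d" "\<Sigma>\<^sub>2 \<in> carrier_mat d d"
  shows "quadro_M \<mu>\<^sub>1 \<mu>\<^sub>2 \<Sigma>\<^sub>1 \<Sigma>\<^sub>2 (unstack_mat d v) (unstack_vec d v)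
    = lin {..<d * d + d} (lin_coeff d \<mu>\<^sub>1 \<mu>\<^sub>2 \<Sigma>\<^sub>1 \<Sigma>\<^sub>2) v"
proof -
  have quad: "\<mu> \<bullet> (unstack_mat d v *\<^sub>v \<mu>) = (\<Sum>c<d. \<Sum>r<d. \<mu> $ r * \<mu> $ c * v (c * d + r))"
    if "\<mu> \<in> carrier_vec d" for \<mu>
  proof -
    have "\<mu> \<bullet> (unstack_mat d v *\<^sub>v \<mu>) = (\<Sum>r<d. \<Sum>c<d. \<mu> $ r * \<mu> $ c * v (c * d + r))"
      using that by (simp add: scalar_prod_def unstack_mat_def atLeast0LessThan sum_distrib_left mult_ac)
    also have "\<dots> = (\<Sum>c<d. \<Sum>r<d. \<mu> $ r * \<mu> $ c * v (c * d + r))" by (rule sum.swap)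
    finally show ?thesis .
  qed
  have "mat_trace (unstack_mat d v * (\<Sigma>\<^sub>1 - \<Sigma>\<^sub>2))
      = (\<Sum>r<d. \<Sum>c<d. (\<Sigma>\<^sub>1 $$ (c, r) - \<Sigma>\<^sub>2 $$ (c, r)) * v (c * d + r))"
    using assms by (simp add: mat_trace_def scalar_prod_def unstack_mat_def atLeast0LessThan mult_ac)
  also have "\<dots> = (\<Sum>c<d. \<Sum>r<d. (\<Sigma>\<^sub>1 $$ (c, r) - \<Sigma>\<^sub>2 $$ (c, r)) * v (c * d + r))" by (rule sum.swap)
  finally have tr: "mat_trace (unstack_mat d v * (\<Sigma>\<^sub>1 - \<Sigma>\<^sub>2))
      = (\<Sum>c<d. \<Sum>r<d. (\<Sigma>\<^sub>1 $$ (c, r) - \<Sigma>\<^sub>2 $$ (c, r)) * v (c * d + r))" .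
  have "2 * ((\<mu>\<^sub>1 - \<mu>\<^sub>2) \<bullet> unstack_vec d v) = (\<Sum>r<d. 2 * (\<mu>\<^sub>1 $ r - \<mu>\<^sub>2 $ r) * v (d * d + r))"
    using assms by (simp add: scalar_prod_def unstack_vec_def atLeast0LessThan sum_distrib_left algebra_simps)
  moreover have "lin {..<d * d + d} (lin_coeff d \<mu>\<^sub>1 \<mu>\<^sub>2 \<Sigma>\<^sub>1 \<Sigma>\<^sub>2) v
      = (\<Sum>c<d. \<Sum>r<d. (\<mu>\<^sub>2 $ r * \<mu>\<^sub>2 $ c - \<mu>\<^sub>1 $ r * \<mu>\<^sub>1 $ c - (\<Sigma>\<^sub>1 $$ (c, r) - \<Sigma>\<^sub>2 $$ (c, r))) * v (c * d + r))
        + (\<Sum>r<d. 2 * (\<mu>\<^sub>1 $ r - \<mu>\<^sub>2 $ r) * v (d * d + r))"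
    unfolding lin_def sum_stack
    by (intro arg_cong2[of _ _ _ _ "(+)"] sum.cong refl) (auto simp: lin_coeff_def stack_index_less)
  ultimately show ?thesis
    using assms by (simp add: quadro_M_def quad tr left_diff_distrib sum_subtractf)
qed

section \<open>Entries of the matrix Q\<close>

lemma quadro_Qk_carrier:
  assumes "\<mu> \<in> carrier_vec d" "\<Sigma> \<in> carrier_mat d d"
  shows "quadro_Qk \<gamma> \<mu> \<Sigma> \<in> carrier_mat (d * d + d) (d * d + d)"
  using assms by (auto simp: quadro_Qk_def mat_of_col_def vec_stack_def intro!: four_block_carrier_mat carrier_matI)

lemma kron_index:
  assumes "c < dim_row A" "r < dim_row B" "c' < dim_col A" "r' < dim_col B"
  shows "kron A B $$ (c * dim_row B + r, c' * dim_col B + r') = A $$ (c, c') * B $$ (r, r')"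
proof -
  have "c * m + r < n * m" if "c < n" "r < m" for c r n m :: nat
  proof -
    have "c * m + r < Suc c * m" using that by simp
    also have "\<dots> \<le> n * m" using that by (intro mult_le_mono1) simp
    finally show ?thesis .
  qed
  then show ?thesis using assms by (simp add: kron_def)
qed

lemma outer_product_index:
  assumes "i < dim_vec u" "j < dim_vec v"
  shows "(mat_of_col u * mat_of_row v) $$ (i, j) = u $ i * v $ j"
  using assms by (simp add: mat_of_col_def scalar_prod_def)

lemma four_block_mat_index:
  assumes "A \<in> carrier_mat m n" "B \<in> carrier_mat m n'" "C \<in> carrier_mat m' n" "D \<in> carrier_mat m' n'"
  shows "i < m \<Longrightarrow> j < n \<Longrightarrow> four_block_mat A B C D $$ (i, j) = A $$ (i, j)"
    "i < m \<Longrightarrow> j' < n' \<Longrightarrow> four_block_mat A B C D $$ (i, n + j') = B $$ (i, j')"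
    "i' < m' \<Longrightarrow> j < n \<Longrightarrow> four_block_mat A B C D $$ (m + i', j) = C $$ (i', j)"
    "i' < m' \<Longrightarrow> j' < n' \<Longrightarrow> four_block_mat A B C D $$ (m + i', n + j') = D $$ (i', j')"
  using assms by auto

text \<open>Symmetry, the quadratic form and the perturbation bound are all checked entry by entry,
  with a stacked index written as column times \<open>d\<close> plus row.\<close>

lemma quadro_Qk_index:
  assumes \<mu>: "\<mu> \<in> carrier_vec d" and \<Sigma>: "\<Sigma> \<in> carrier_mat d d"
    and "c < d" "r < d" "c' < d" "r' < d"
  shows "quadro_Qk \<gamma> \<mu> \<Sigma> $$ (c * d + r, c' * d + r') =
      (2 * (1 + \<gamma>) * \<Sigma> $$ (c, c') + 4 * (\<mu> $ c * \<mu> $ c')) * \<Sigma> $$ (r, r')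
      + \<gamma> * (\<Sigma> $$ (r, c) * \<Sigma> $$ (r', c'))" (is ?A)
    and "quadro_Qk \<gamma> \<mu> \<Sigma> $$ (c * d + r, d * d + r') = - 4 * (\<mu> $ c * \<Sigma> $$ (r, r'))" (is ?B)
    and "quadro_Qk \<gamma> \<mu> \<Sigma> $$ (d * d + r, c' * d + r') = - 4 * (\<mu> $ c' * \<Sigma> $$ (r, r'))" (is ?C)
    and "quadro_Qk \<gamma> \<mu> \<Sigma> $$ (d * d + r, d * d + r') = 4 * \<Sigma> $$ (r, r')" (is ?D)
proof -
  note i = stack_index_less[OF assms(3,4)] stack_index_less[OF assms(5,6)]
  define K where "K = kron ((2 * (1 + \<gamma>)) \<cdot>\<^sub>m \<Sigma> + 4 \<cdot>\<^sub>m (mat_of_col \<mu> * mat_of_row \<mu>)) \<Sigma>"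
  define V where "V = mat_of_col (vec_stack \<Sigma>) * mat_of_row (vec_stack \<Sigma>)"
  define K1 where "K1 = kron (mat_of_col \<mu>) \<Sigma>"
  define K2 where "K2 = kron (mat_of_row \<mu>) \<Sigma>"
  have dims: "dim_vec \<mu> = d" "dim_row \<Sigma> = d" "dim_col \<Sigma> = d" using assms by auto
  have cols: "dim_row (mat_of_col \<mu>) = d" "dim_col (mat_of_col \<mu>) = 1"
    by (simp_all add: mat_of_col_def dims)
  have carr: "K \<in> carrier_mat (d * d) (d * d)" "V \<in> carrier_mat (d * d) (d * d)"
    "K1 \<in> carrier_mat (d * d) d" "K2 \<in> carrier_mat d (d * d)"
    by (auto simp: K_def V_def K1_def K2_def kron_def mat_of_col_def vec_stack_def dims)
  have K: "K $$ (c * d + r, c' * d + r') =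
      (2 * (1 + \<gamma>) * \<Sigma> $$ (c, c') + 4 * (\<mu> $ c * \<mu> $ c')) * \<Sigma> $$ (r, r')"
    using kron_index[of c _ r \<Sigma> c' r'] assms(3-6)
    by (simp add: K_def dims cols outer_product_index del: index_mult_mat(1))
  have V: "V $$ (c * d + r, c' * d + r') = \<Sigma> $$ (r, c) * \<Sigma> $$ (r', c')"
  proof -
    have "vec_stack \<Sigma> $ (c * d + r) = \<Sigma> $$ (r, c)" "vec_stack \<Sigma> $ (c' * d + r') = \<Sigma> $$ (r', c')"
      using i assms(3-6) by (simp_all add: vec_stack_def dims)
    moreover have "dim_vec (vec_stack \<Sigma>) = d * d" by (simp add: vec_stack_def dims)
    ultimately show ?thesis unfolding V_def using i by (subst outer_product_index) simp_all
  qed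
  have K1: "K1 $$ (c * d + r, r') = \<mu> $ c * \<Sigma> $$ (r, r')"
    using kron_index[of c "mat_of_col \<mu>" r \<Sigma> 0 r'] assms(3-6)
    by (simp add: K1_def dims cols) (simp add: mat_of_col_def dims)
  have K2: "K2 $$ (r, c' * d + r') = \<mu> $ c' * \<Sigma> $$ (r, r')"
    using kron_index[of 0 "mat_of_row \<mu>" r \<Sigma> c' r'] assms(3-6) by (simp add: K2_def dims)
  have Q: "quadro_Qk \<gamma> \<mu> \<Sigma> = four_block_mat (K + \<gamma> \<cdot>\<^sub>m V) ((-4) \<cdot>\<^sub>m K1) ((-4) \<cdot>\<^sub>m K2) (4 \<cdot>\<^sub>m \<Sigma>)"
    by (simp add: quadro_Qk_def K_def V_def K1_def K2_def)
  note fb = four_block_mat_index[OF _ _ _ \<Sigma>[THEN smult_carrier_mat],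
      where A = "K + \<gamma> \<cdot>\<^sub>m V" and B = "(-4) \<cdot>\<^sub>m K1" and C = "(-4) \<cdot>\<^sub>m K2"]
  have blocks: "K + \<gamma> \<cdot>\<^sub>m V \<in> carrier_mat (d * d) (d * d)"
    "(-4) \<cdot>\<^sub>m K1 \<in> carrier_mat (d * d) d" "(-4) \<cdot>\<^sub>m K2 \<in> carrier_mat d (d * d)"
    using carr by auto
  show ?A unfolding Q fb(1)[OF blocks i] using carr i by (simp add: K V carrier_matD[of V])
  show ?B unfolding Q fb(2)[OF blocks i(1) assms(6)] using carr i assms(6) by (simp add: K1 carrier_matD[of K1])
  show ?C unfolding Q fb(3)[OF blocks assms(4) i(2)] using carr i assms(4) by (simp add: K2 carrier_matD[of K2])
  show ?D unfolding Q fb(4)[OF blocks assms(4,6)] using assms(4,6) by (simp add: dims)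
qed

section \<open>L as the quadratic form of Q, and its nonnegativity\<close>

lemma bil_sum_left: "bil I Q (\<lambda>r. \<Sum>c\<in>K. f c r) y = (\<Sum>c\<in>K. bil I Q (f c) y)"
proof -
  have "bil I Q (\<lambda>r. \<Sum>c\<in>K. f c r) y = (\<Sum>i\<in>I. \<Sum>c\<in>K. \<Sum>j\<in>I. f c i * Q i j * y j)"
    unfolding bil_def by (intro sum.cong refl) (simp add: sum_distrib_right sum.swap[of _ K I])
  then show ?thesis by (simp add: bil_def sum.swap[of _ K I])
qed

lemma bil_sum_right: "bil I Q y (\<lambda>r. \<Sum>c\<in>K. f c r) = (\<Sum>c\<in>K. bil I Q y (f c))"
proof -
  have "bil I Q y (\<lambda>r. \<Sum>c\<in>K. f c r) = (\<Sum>i\<in>I. \<Sum>c\<in>K. \<Sum>j\<in>I. y i * Q i j * f c j)"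
    unfolding bil_def by (intro sum.cong refl) (simp add: sum_distrib_left sum.swap[of _ K I])
  then show ?thesis by (simp add: bil_def sum.swap[of _ K I])
qed

lemma scalar_prod_mult_mat_vec:
  assumes "u \<in> carrier_vec d" "w \<in> carrier_vec d" "A \<in> carrier_mat d d"
  shows "u \<bullet> (A *\<^sub>v w) = bil {..<d} (\<lambda>i j. A $$ (i, j)) (\<lambda>i. u $ i) (\<lambda>i. w $ i)"
  using assms by (simp add: bil_def scalar_prod_def atLeast0LessThan sum_distrib_left mult.assoc)

lemma bil_cong:
  assumes "\<And>i. i \<in> I \<Longrightarrow> x i = x' i" "\<And>i. i \<in> I \<Longrightarrow> y i = y' i"
  shows "bil I Q x y = bil I Q x' y'"
  unfolding bil_def using assms by (intro sum.cong refl) simp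

lemma pos_semidef_bil:
  assumes "pos_semidef d A"
  shows "0 \<le> bil {..<d} (\<lambda>i j. A $$ (i, j)) v v"
proof -
  have "bil {..<d} (\<lambda>i j. A $$ (i, j)) v v
      = bil {..<d} (\<lambda>i j. A $$ (i, j)) (\<lambda>i. vec d v $ i) (\<lambda>i. vec d v $ i)"
    by (rule bil_cong) auto
  also have "\<dots> = vec d v \<bullet> (A *\<^sub>v vec d v)"
    using assms by (intro scalar_prod_mult_mat_vec[symmetric]) (auto simp: pos_semidef_def)
  finally show ?thesis using assms by (simp add: pos_semidef_def)
qed

lemma pos_def_imp_pos_semidef:
  assumes "pos_def d A"
  shows "pos_semidef d A"
  unfolding pos_semidef_def
proof (intro conjI ballI)
  show A: "A \<in> carrier_mat d d" and "transpose_mat A = A" using assms by (auto simp: pos_def_def)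
  fix v :: "real vec" assume v: "v \<in> carrier_vec d"
  show "0 \<le> v \<bullet> (A *\<^sub>v v)"
  proof (cases "v = 0\<^sub>v d")
    case True
    then show ?thesis using A by (simp add: scalar_prod_def)
  next
    case False
    then show ?thesis using assms v by (simp add: pos_def_def less_imp_le)
  qed
qed

lemma symmetric_mat_index:
  assumes "A \<in> carrier_mat d d" "transpose_mat A = A" "i < d" "j < d"
  shows "A $$ (i, j) = A $$ (j, i)"
  using assms by (metis carrier_matD index_transpose_mat(1))

text \<open>\<open>W v c\<close> is column \<open>c\<close> of \<Omega>. The product of the
  transpose of \<Omega>, \<Sigma> and \<Omega> has as entries the forms of \<Sigma> at pairs of
  columns, so the first trace becomes an entrywise pairing of this Gram matrix with
  \<Sigma>.\<close>

lemma quadro_Lk_unstack: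
  assumes \<mu>: "\<mu> \<in> carrier_vec d" and \<Sigma>: "pos_semidef d \<Sigma>"
  defines "F \<equiv> \<lambda>i j. \<Sigma> $$ (i, j)" and "W \<equiv> \<lambda>v c r. v (c * d + r)" and "D \<equiv> \<lambda>v r. v (d * d + r)"
  shows "quadro_Lk \<gamma> \<mu> \<Sigma> (unstack_mat d v) (unstack_vec d v) =
    2 * (1 + \<gamma>) * (\<Sum>c<d. \<Sum>c'<d. F c c' * bil {..<d} F (W v c) (W v c'))
    + \<gamma> * (\<Sum>c<d. \<Sum>r<d. W v c r * F r c)\<^sup>2
    + 4 * bil {..<d} F (\<lambda>r. (\<Sum>c<d. \<mu> $ c * W v c r) - D v r) (\<lambda>r. (\<Sum>c<d. \<mu> $ c * W v c r) - D v r)"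
proof -
  let ?\<Omega> = "unstack_mat d v" and ?\<delta> = "unstack_vec d v"
  have carr: "\<Sigma> \<in> carrier_mat d d" "?\<Omega> \<in> carrier_mat d d" "?\<delta> \<in> carrier_vec d"
    using \<Sigma> by (auto simp: pos_semidef_def unstack_mat_def unstack_vec_def)
  have symF: "F i j = F j i" if "i < d" "j < d" for i j
    using \<Sigma> that unfolding F_def pos_semidef_def by (intro symmetric_mat_index) auto
  have \<Omega>: "?\<Omega> $$ (r, c) = W v c r" if "r < d" "c < d" for r c
    using that by (simp add: unstack_mat_def W_def)
  have prod: "(transpose_mat ?\<Omega> * \<Sigma> * ?\<Omega>) $$ (c, c') = bil {..<d} F (W v c) (W v c')"
    if "c < d" "c' < d" for c c'
  proof -
    have "(transpose_mat ?\<Omega> * \<Sigma> * ?\<Omega>) $$ (c, c')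
        = (\<Sum>r<d. W v c r * (\<Sum>r'<d. F r r' * W v c' r'))"
      using that carr by (simp add: scalar_prod_def atLeast0LessThan \<Omega> F_def)
    also have "\<dots> = bil {..<d} F (W v c) (W v c')"
      by (simp add: bil_def sum_distrib_left mult.assoc)
    finally show ?thesis .
  qed
  have pc: "transpose_mat ?\<Omega> * \<Sigma> * ?\<Omega> \<in> carrier_mat d d" using carr by auto
  have "mat_trace (transpose_mat ?\<Omega> * \<Sigma> * ?\<Omega> * \<Sigma>)
      = (\<Sum>c<d. \<Sum>c'<d. (transpose_mat ?\<Omega> * \<Sigma> * ?\<Omega>) $$ (c, c') * F c' c)"
    using pc carr
    by (simp add: mat_trace_def scalar_prod_def[of "row _ _"] atLeast0LessThan F_def del: index_mult_mat(1))
       (intro sum.cong refl, subst index_mult_mat(1), auto simp: scalar_prod_def[of "row _ _"] atLeast0LessThan simp del: index_mult_mat(1))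
  also have "\<dots> = (\<Sum>c<d. \<Sum>c'<d. F c c' * bil {..<d} F (W v c) (W v c'))"
    by (intro sum.cong refl) (simp add: prod symF del: index_mult_mat(1))
  finally have t1: "mat_trace (transpose_mat ?\<Omega> * \<Sigma> * ?\<Omega> * \<Sigma>)
      = (\<Sum>c<d. \<Sum>c'<d. F c c' * bil {..<d} F (W v c) (W v c'))" .
  have "mat_trace (?\<Omega> * \<Sigma>) = (\<Sum>r<d. \<Sum>c<d. W v c r * F c r)"
    using carr by (simp add: mat_trace_def scalar_prod_def atLeast0LessThan F_def \<Omega>)
  also have "\<dots> = (\<Sum>r<d. \<Sum>c<d. W v c r * F r c)"
    by (intro sum.cong refl) (simp add: symF)
  also have "\<dots> = (\<Sum>c<d. \<Sum>r<d. W v c r * F r c)" by (rule sum.swap)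
  finally have t2: "mat_trace (?\<Omega> * \<Sigma>) = (\<Sum>c<d. \<Sum>r<d. W v c r * F r c)" .
  have vc: "?\<Omega> *\<^sub>v \<mu> - ?\<delta> \<in> carrier_vec d" using carr \<mu> by auto
  have vi: "(?\<Omega> *\<^sub>v \<mu> - ?\<delta>) $ r = (\<Sum>c<d. \<mu> $ c * W v c r) - D v r" if "r < d" for r
    using that carr \<mu>
    by (simp add: scalar_prod_def atLeast0LessThan \<Omega> mult.commute) (simp add: unstack_vec_def D_def)
  have t3: "(?\<Omega> *\<^sub>v \<mu> - ?\<delta>) \<bullet> (\<Sigma> *\<^sub>v (?\<Omega> *\<^sub>v \<mu> - ?\<delta>))
      = bil {..<d} F (\<lambda>r. (\<Sum>c<d. \<mu> $ c * W v c r) - D v r) (\<lambda>r. (\<Sum>c<d. \<mu> $ c * W v c r) - D v r)"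
    unfolding scalar_prod_mult_mat_vec[OF vc vc carr(1)] F_def[symmetric]
    by (rule bil_cong) (simp_all only: vi lessThan_iff)
  show ?thesis unfolding quadro_Lk_def t1 t2 t3 ..
qed

text \<open>The trace term pairs \<Sigma> with the Gram matrix of the columns of \<Omega>. Both are
  positive semidefinite, so \<open>trace_product_nonneg\<close> applies.\<close>

lemma quadro_Lk_nonneg:
  assumes "\<mu> \<in> carrier_vec d" and \<Sigma>: "pos_semidef d \<Sigma>" and "\<gamma> \<ge> 0"
  shows "0 \<le> quadro_Lk \<gamma> \<mu> \<Sigma> (unstack_mat d v) (unstack_vec d v)"
proof -
  let ?F = "\<lambda>i j. \<Sigma> $$ (i, j)" and ?W = "\<lambda>c r. v (c * d + r)"
  have "0 \<le> (\<Sum>c<d. \<Sum>c'<d. ?F c c' * bil {..<d} ?F (?W c) (?W c'))"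
  proof (rule trace_product_nonneg)
    \<comment> \<open>The form of the Gram matrix at \<open>x\<close> is the form of \<Sigma> at the
      combination of the columns with weights \<open>x\<close>.\<close>
    show "0 \<le> bil {..<d} (\<lambda>c c'. bil {..<d} ?F (?W c) (?W c')) x x" for x
    proof -
      have "bil {..<d} (\<lambda>c c'. bil {..<d} ?F (?W c) (?W c')) x x
          = bil {..<d} ?F (\<lambda>r. \<Sum>c<d. x c * ?W c r) (\<lambda>r. \<Sum>c<d. x c * ?W c r)"
        unfolding bil_sum_left bil_sum_right bil_scale
        by (subst bil_def) (simp add: sum_distrib_left mult_ac)
      then show ?thesis using pos_semidef_bil[OF \<Sigma>] by simp
    qed
    show "?F i j = ?F j i" if "i \<in> {..<d}" "j \<in> {..<d}" for i j
      using \<Sigma> that unfolding pos_semidef_def by (intro symmetric_mat_index) auto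
  qed (simp_all add: pos_semidef_bil[OF \<Sigma>])
  then show ?thesis
    unfolding quadro_Lk_unstack[OF assms(1,2)] using \<open>\<gamma> \<ge> 0\<close> pos_semidef_bil[OF \<Sigma>]
    by (intro add_nonneg_nonneg mult_nonneg_nonneg) auto
qed

text \<open>The sum splits into the four blocks. The parts of the upper left block with factors
  \<open>2 * (1 + \<gamma>)\<close> and \<gamma> yield the two trace terms; its part in \<mu> and
  the other three blocks complete the square at \<open>\<Omega> \<mu> - \<delta>\<close>.\<close>

lemma bil_quadro_Qk:
  assumes \<mu>: "\<mu> \<in> carrier_vec d" and \<Sigma>: "pos_semidef d \<Sigma>"
  shows "bil {..<d * d + d} (\<lambda>i j. quadro_Qk \<gamma> \<mu> \<Sigma> $$ (i, j)) v v
    = quadro_Lk \<gamma> \<mu> \<Sigma> (unstack_mat d v) (unstack_vec d v)"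
proof -
  define F where "F = (\<lambda>i j. \<Sigma> $$ (i, j))"
  define W where "W = (\<lambda>c r. v (c * d + r))"
  define D where "D = (\<lambda>r. v (d * d + r))"
  let ?I = "{..<d}"
  have carr: "\<Sigma> \<in> carrier_mat d d" using \<Sigma> by (simp add: pos_semidef_def)
  have idx: "quadro_Qk \<gamma> \<mu> \<Sigma> $$ (c * d + r, c' * d + r') =
      (2 * (1 + \<gamma>) * F c c' + 4 * (\<mu> $ c * \<mu> $ c')) * F r r' + \<gamma> * (F r c * F r' c')"
    "quadro_Qk \<gamma> \<mu> \<Sigma> $$ (c * d + r, d * d + r') = - 4 * (\<mu> $ c * F r r')"
    "quadro_Qk \<gamma> \<mu> \<Sigma> $$ (d * d + r, c' * d + r') = - 4 * (\<mu> $ c' * F r r')"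
    "quadro_Qk \<gamma> \<mu> \<Sigma> $$ (d * d + r, d * d + r') = 4 * F r r'"
    if "c < d" "r < d" "c' < d" "r' < d" for c r c' r'
    using quadro_Qk_index[OF \<mu> carr that] by (simp_all add: F_def)
  have block11: "(\<Sum>c<d. \<Sum>r<d. \<Sum>c'<d. \<Sum>r'<d.
        W c r * quadro_Qk \<gamma> \<mu> \<Sigma> $$ (c * d + r, c' * d + r') * W c' r')
      = 2 * (1 + \<gamma>) * (\<Sum>c<d. \<Sum>c'<d. F c c' * bil ?I F (W c) (W c'))
        + 4 * (\<Sum>c<d. \<Sum>c'<d. \<mu> $ c * \<mu> $ c' * bil ?I F (W c) (W c'))
        + \<gamma> * (\<Sum>c<d. \<Sum>r<d. W c r * F r c)\<^sup>2" (is "?L = _")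
  proof -
    have "?L = (\<Sum>c<d. \<Sum>c'<d. \<Sum>r<d. \<Sum>r'<d.
        W c r * quadro_Qk \<gamma> \<mu> \<Sigma> $$ (c * d + r, c' * d + r') * W c' r')"
      by (intro sum.cong refl sum.swap)
    also have "\<dots> = (\<Sum>c<d. \<Sum>c'<d. \<Sum>r<d. \<Sum>r'<d.
        (2 * (1 + \<gamma>) * F c c' + 4 * (\<mu> $ c * \<mu> $ c')) * (W c r * F r r' * W c' r')
        + \<gamma> * ((W c r * F r c) * (W c' r' * F r' c')))"
    proof (intro sum.cong refl)
      have ident: "w * (p * f + g * (e * e')) * w' = p * (w * f * w') + g * (w * e * (w' * e'))"
        for w p f g e e' w' :: real by (simp add: algebra_simps)
      fix c c' r r' assume "c \<in> {..<d}" "c' \<in> {..<d}" "r \<in> {..<d}" "r' \<in> {..<d}"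
      then have *: "c < d" "r < d" "c' < d" "r' < d" by auto
      show "W c r * quadro_Qk \<gamma> \<mu> \<Sigma> $$ (c * d + r, c' * d + r') * W c' r' =
        (2 * (1 + \<gamma>) * F c c' + 4 * (\<mu> $ c * \<mu> $ c')) * (W c r * F r r' * W c' r')
        + \<gamma> * ((W c r * F r c) * (W c' r' * F r' c'))"
        unfolding idx(1)[OF *] by (rule ident)
    qed
    also have "\<dots> = (\<Sum>c<d. \<Sum>c'<d.
        (2 * (1 + \<gamma>) * F c c' + 4 * (\<mu> $ c * \<mu> $ c')) * bil ?I F (W c) (W c')
        + \<gamma> * ((\<Sum>r<d. W c r * F r c) * (\<Sum>r'<d. W c' r' * F r' c')))"
      by (intro sum.cong refl)
         (simp only: sum.distrib bil_def sum_distrib_left[symmetric] sum_product)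
    also have "\<dots> = (\<Sum>c<d. \<Sum>c'<d.
        2 * (1 + \<gamma>) * (F c c' * bil ?I F (W c) (W c')) + 4 * (\<mu> $ c * \<mu> $ c' * bil ?I F (W c) (W c'))
        + \<gamma> * ((\<Sum>r<d. W c r * F r c) * (\<Sum>r'<d. W c' r' * F r' c')))"
      by (intro sum.cong refl) (simp only: distrib_right mult.assoc)
    also have "\<dots> = 2 * (1 + \<gamma>) * (\<Sum>c<d. \<Sum>c'<d. F c c' * bil ?I F (W c) (W c'))
        + 4 * (\<Sum>c<d. \<Sum>c'<d. \<mu> $ c * \<mu> $ c' * bil ?I F (W c) (W c'))
        + \<gamma> * (\<Sum>c<d. \<Sum>r<d. W c r * F r c)\<^sup>2"
      by (simp only: sum.distrib sum_distrib_left[symmetric] power2_eq_square sum_product)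
    finally show ?thesis .
  qed
  have block12: "(\<Sum>c<d. \<Sum>r<d. \<Sum>r'<d. W c r * quadro_Qk \<gamma> \<mu> \<Sigma> $$ (c * d + r, d * d + r') * D r')
      = - 4 * (\<Sum>c<d. \<mu> $ c * bil ?I F (W c) D)"
    unfolding bil_def sum_distrib_left by (intro sum.cong refl) (simp add: idx)
  have "(\<Sum>r<d. \<Sum>c<d. \<Sum>r'<d. D r * quadro_Qk \<gamma> \<mu> \<Sigma> $$ (d * d + r, c * d + r') * W c r')
      = (\<Sum>c<d. \<Sum>r<d. \<Sum>r'<d. D r * quadro_Qk \<gamma> \<mu> \<Sigma> $$ (d * d + r, c * d + r') * W c r')"
    by (rule sum.swap)
  also have "\<dots> = - 4 * (\<Sum>c<d. \<mu> $ c * bil ?I F D (W c))"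
    unfolding bil_def sum_distrib_left by (intro sum.cong refl) (simp add: idx)
  finally have block21: "(\<Sum>r<d. \<Sum>c<d. \<Sum>r'<d. D r * quadro_Qk \<gamma> \<mu> \<Sigma> $$ (d * d + r, c * d + r') * W c r')
      = - 4 * (\<Sum>c<d. \<mu> $ c * bil ?I F D (W c))" .
  have block22: "(\<Sum>r<d. \<Sum>r'<d. D r * quadro_Qk \<gamma> \<mu> \<Sigma> $$ (d * d + r, d * d + r') * D r')
      = 4 * bil ?I F D D"
    \<comment> \<open>The lower right block involves no column indices of \<Omega>; 0 stands in for
      them, and \<open>0 < d\<close> follows from the row index.\<close>
    unfolding bil_def sum_distrib_left by (intro sum.cong refl) (simp add: idx(4)[of 0 _ 0])
  let ?w = "\<lambda>r. \<Sum>c<d. \<mu> $ c * W c r"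
  have "bil ?I F (\<lambda>r. ?w r - D r) (\<lambda>r. ?w r - D r)
      = bil ?I F ?w ?w - bil ?I F ?w D - bil ?I F D ?w + bil ?I F D D"
    using bil_add_scale_left[of ?I F ?w "-1" D] bil_add_scale_right[of ?I F _ ?w "-1" D]
    by simp
  moreover have "bil ?I F ?w ?w = (\<Sum>c<d. \<Sum>c'<d. \<mu> $ c * \<mu> $ c' * bil ?I F (W c) (W c'))"
    unfolding bil_sum_left bil_sum_right bil_scale by (simp add: sum_distrib_left mult_ac)
  moreover have "bil ?I F ?w D = (\<Sum>c<d. \<mu> $ c * bil ?I F (W c) D)"
    unfolding bil_sum_left bil_scale ..
  moreover have "bil ?I F D ?w = (\<Sum>c<d. \<mu> $ c * bil ?I F D (W c))"
    unfolding bil_sum_right bil_scale ..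
  moreover have "bil {..<d * d + d} (\<lambda>i j. quadro_Qk \<gamma> \<mu> \<Sigma> $$ (i, j)) v v
      = (\<Sum>c<d. \<Sum>r<d. \<Sum>c'<d. \<Sum>r'<d. W c r * quadro_Qk \<gamma> \<mu> \<Sigma> $$ (c * d + r, c' * d + r') * W c' r')
        + (\<Sum>c<d. \<Sum>r<d. \<Sum>r'<d. W c r * quadro_Qk \<gamma> \<mu> \<Sigma> $$ (c * d + r, d * d + r') * D r')
        + ((\<Sum>r<d. \<Sum>c<d. \<Sum>r'<d. D r * quadro_Qk \<gamma> \<mu> \<Sigma> $$ (d * d + r, c * d + r') * W c r')
        + (\<Sum>r<d. \<Sum>r'<d. D r * quadro_Qk \<gamma> \<mu> \<Sigma> $$ (d * d + r, d * d + r') * D r'))"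
    unfolding bil_def sum_stack W_def D_def by (simp only: sum.distrib)
  moreover have "quadro_Lk \<gamma> \<mu> \<Sigma> (unstack_mat d v) (unstack_vec d v) =
    2 * (1 + \<gamma>) * (\<Sum>c<d. \<Sum>c'<d. F c c' * bil ?I F (W c) (W c'))
    + \<gamma> * (\<Sum>c<d. \<Sum>r<d. W c r * F r c)\<^sup>2
    + 4 * bil ?I F (\<lambda>r. ?w r - D r) (\<lambda>r. ?w r - D r)"
    unfolding F_def W_def D_def by (rule quadro_Lk_unstack[OF \<mu> \<Sigma>])
  ultimately show ?thesis
    unfolding block11 block12 block21 block22 by (simp add: algebra_simps)
qed

section \<open>Perturbation bounds and translation\<close>

text \<open>Telescoping the product. The bounds 1 and 2 fit a population entry and its estimate,
  whose error is at most 1 by the standing assumptions.\<close>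

lemma abs_mult_diff_le:
  fixes a b a' b' :: real
  assumes "\<bar>a' - a\<bar> \<le> e" "\<bar>b' - b\<bar> \<le> f" "\<bar>a\<bar> \<le> 1" "\<bar>b'\<bar> \<le> 2"
  shows "\<bar>a' * b' - a * b\<bar> \<le> 2 * e + f"
proof -
  have "a' * b' - a * b = (a' - a) * b' + a * (b' - b)" by (simp add: algebra_simps)
  also have "\<bar>\<dots>\<bar> \<le> \<bar>a' - a\<bar> * \<bar>b'\<bar> + \<bar>a\<bar> * \<bar>b' - b\<bar>"
    by (metis abs_mult abs_triangle_ineq)
  also have "\<dots> \<le> e * 2 + 1 * f" using assms by (intro add_mono mult_mono) auto
  finally show ?thesis by simp
qed

lemma stack_index_cases [consumes 1]:
  fixes d :: nat
  assumes "i < d * d + d"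
  obtains (mat) c r where "c < d" "r < d" "i = c * d + r" | (vec) r where "r < d" "i = d * d + r"
proof (cases "i < d * d")
  case True
  then have "d > 0" by (cases d) auto
  then have "i div d < d" "i mod d < d" "i = (i div d) * d + i mod d"
    using True by (simp_all add: less_mult_imp_div_less)
  then show ?thesis using mat by blast
next
  case False
  then have "i - d * d < d" "i = d * d + (i - d * d)" using assms by auto
  then show ?thesis using vec by blast
qed

lemma vec_linf_index: "i < dim_vec v \<Longrightarrow> \<bar>v $ i\<bar> \<le> vec_linf v"
  unfolding vec_linf_def by (intro Max_ge) auto

lemma mat_linf_index: "i < dim_row A \<Longrightarrow> j < dim_col A \<Longrightarrow> \<bar>A $$ (i, j)\<bar> \<le> mat_linf A"
  unfolding mat_linf_def by (intro Max_ge) auto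

lemma quadro_Qk_symmetric:
  assumes \<mu>: "\<mu> \<in> carrier_vec d" and \<Sigma>: "pos_semidef d \<Sigma>"
    and i: "i < d * d + d" and j: "j < d * d + d"
  shows "quadro_Qk \<gamma> \<mu> \<Sigma> $$ (i, j) = quadro_Qk \<gamma> \<mu> \<Sigma> $$ (j, i)"
proof -
  have carr: "\<Sigma> \<in> carrier_mat d d" using \<Sigma> by (simp add: pos_semidef_def)
  note ix = quadro_Qk_index[OF \<mu> carr]
  have sym: "\<Sigma> $$ (a, b) = \<Sigma> $$ (b, a)" if "a < d" "b < d" for a b
    using \<Sigma> that unfolding pos_semidef_def by (intro symmetric_mat_index) auto
  from i show ?thesis
  proof (cases rule: stack_index_cases)
    case i: (mat c r)
    from j show ?thesis
    proof (cases rule: stack_index_cases)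
      case j: (mat c' r')
      show ?thesis using i j sym[of c c'] sym[of r r'] by (simp add: ix)
    next
      case j: (vec r')
      show ?thesis using i j sym[of r r'] by (simp add: ix)
    qed
  next
    case i: (vec r)
    from j show ?thesis
    proof (cases rule: stack_index_cases)
      case j: (mat c' r')
      show ?thesis using i j sym[of r r'] by (simp add: ix)
    next
      case j: (vec r')
      show ?thesis using i j sym[of r r'] by (simp add: ix)
    qed
  qed
qed

text \<open>The largest error occurs in the upper left block: \<open>2 * (1 + \<gamma>) * 3 + 4 * 7
  + \<gamma> * 3 = 34 + 9 * \<gamma>\<close>. The other blocks need only 12.\<close>

lemma quadro_Qk_deviation:
  assumes \<mu>: "\<mu> \<in> carrier_vec d" "\<mu>' \<in> carrier_vec d"
    and \<Sigma>: "\<Sigma> \<in> carrier_mat d d" "\<Sigma>' \<in> carrier_mat d d" and "\<gamma> \<ge> 0" "0 \<le> \<Delta>"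
    and \<mu>_le: "\<And>i. i < d \<Longrightarrow> \<bar>\<mu> $ i\<bar> \<le> 1" "\<And>i. i < d \<Longrightarrow> \<bar>\<mu>' $ i\<bar> \<le> 2"
    and \<Sigma>_le: "\<And>i j. i < d \<Longrightarrow> j < d \<Longrightarrow> \<bar>\<Sigma> $$ (i, j)\<bar> \<le> 1"
      "\<And>i j. i < d \<Longrightarrow> j < d \<Longrightarrow> \<bar>\<Sigma>' $$ (i, j)\<bar> \<le> 2"
    and \<mu>_dev: "\<And>i. i < d \<Longrightarrow> \<bar>\<mu>' $ i - \<mu> $ i\<bar> \<le> \<Delta>"
    and \<Sigma>_dev: "\<And>i j. i < d \<Longrightarrow> j < d \<Longrightarrow> \<bar>\<Sigma>' $$ (i, j) - \<Sigma> $$ (i, j)\<bar> \<le> \<Delta>"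
    and i: "i < d * d + d" and j: "j < d * d + d"
  shows "\<bar>quadro_Qk \<gamma> \<mu>' \<Sigma>' $$ (i, j) - quadro_Qk \<gamma> \<mu> \<Sigma> $$ (i, j)\<bar> \<le> (34 + 9 * \<gamma>) * \<Delta>"
proof -
  have \<Sigma>\<Sigma>: "\<bar>\<Sigma>' $$ (a, b) * \<Sigma>' $$ (e, f) - \<Sigma> $$ (a, b) * \<Sigma> $$ (e, f)\<bar> \<le> 3 * \<Delta>"
    if "a < d" "b < d" "e < d" "f < d" for a b e f
    using abs_mult_diff_le[OF \<Sigma>_dev \<Sigma>_dev \<Sigma>_le] that by simp
  have \<mu>\<Sigma>: "\<bar>\<mu>' $ a * \<Sigma>' $$ (e, f) - \<mu> $ a * \<Sigma> $$ (e, f)\<bar> \<le> 3 * \<Delta>"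
    if "a < d" "e < d" "f < d" for a e f
    using abs_mult_diff_le[OF \<mu>_dev \<Sigma>_dev \<mu>_le(1) \<Sigma>_le(2)] that by simp
  have \<mu>\<mu>: "\<bar>\<mu>' $ a * \<mu>' $ b - \<mu> $ a * \<mu> $ b\<bar> \<le> 3 * \<Delta>" if "a < d" "b < d" for a b
    using abs_mult_diff_le[OF \<mu>_dev \<mu>_dev \<mu>_le] that by simp
  \<comment> \<open>A product of two means is off by at most \<open>3 * \<Delta>\<close>, so the
    triple product is off by \<open>2 * (3 * \<Delta>) + \<Delta>\<close>.\<close>
  have \<mu>\<mu>\<Sigma>: "\<bar>(\<mu>' $ a * \<mu>' $ b) * \<Sigma>' $$ (e, f) - (\<mu> $ a * \<mu> $ b) * \<Sigma> $$ (e, f)\<bar> \<le> 7 * \<Delta>"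
    if "a < d" "b < d" "e < d" "f < d" for a b e f
  proof -
    have "\<bar>\<mu> $ a * \<mu> $ b\<bar> \<le> 1" using \<mu>_le(1) that by (simp add: abs_mult mult_le_one)
    then show ?thesis using abs_mult_diff_le[OF \<mu>\<mu> \<Sigma>_dev _ \<Sigma>_le(2)] that by simp
  qed
  have small: "k * \<Delta> \<le> (34 + 9 * \<gamma>) * \<Delta>" if "k \<le> 34" for k
    using that \<open>\<gamma> \<ge> 0\<close> \<open>0 \<le> \<Delta>\<close> by (intro mult_right_mono) auto
  have scaled: "\<bar>4 * p\<bar> \<le> (34 + 9 * \<gamma>) * \<Delta>" if "\<bar>p\<bar> \<le> 3 * \<Delta>" for p
    using that small[of 12] by (simp add: abs_mult)
  from i show ?thesis
  proof (cases rule: stack_index_cases)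
    case i: (mat c r)
    from j show ?thesis
    proof (cases rule: stack_index_cases)
      case j: (mat c' r')
      let ?p = "\<Sigma>' $$ (c, c') * \<Sigma>' $$ (r, r') - \<Sigma> $$ (c, c') * \<Sigma> $$ (r, r')"
      let ?q = "(\<mu>' $ c * \<mu>' $ c') * \<Sigma>' $$ (r, r') - (\<mu> $ c * \<mu> $ c') * \<Sigma> $$ (r, r')"
      let ?s = "\<Sigma>' $$ (r, c) * \<Sigma>' $$ (r', c') - \<Sigma> $$ (r, c) * \<Sigma> $$ (r', c')"
      have "quadro_Qk \<gamma> \<mu>' \<Sigma>' $$ (i, j) - quadro_Qk \<gamma> \<mu> \<Sigma> $$ (i, j)
          = 2 * (1 + \<gamma>) * ?p + 4 * ?q + \<gamma> * ?s"
        using i j \<mu> \<Sigma> by (simp add: quadro_Qk_index) (simp add: algebra_simps)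
      also have "\<bar>\<dots>\<bar> \<le> \<bar>2 * (1 + \<gamma>) * ?p\<bar> + \<bar>4 * ?q\<bar> + \<bar>\<gamma> * ?s\<bar>" by linarith
      also have "\<dots> = 2 * (1 + \<gamma>) * \<bar>?p\<bar> + 4 * \<bar>?q\<bar> + \<gamma> * \<bar>?s\<bar>"
        using \<open>\<gamma> \<ge> 0\<close> by (simp only: abs_mult) simp
      also have "\<dots> \<le> 2 * (1 + \<gamma>) * (3 * \<Delta>) + 4 * (7 * \<Delta>) + \<gamma> * (3 * \<Delta>)"
        using \<Sigma>\<Sigma> \<mu>\<mu>\<Sigma> i j \<open>\<gamma> \<ge> 0\<close> by (intro add_mono mult_left_mono) auto
      also have "\<dots> = (34 + 9 * \<gamma>) * \<Delta>" by (simp add: algebra_simps)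
      finally show ?thesis .
    next
      case j: (vec r')
      show ?thesis using i j \<mu> \<Sigma> scaled[OF \<mu>\<Sigma>[of c r r']]
        by (simp add: quadro_Qk_index abs_minus_commute right_diff_distrib)
    qed
  next
    case i: (vec r)
    from j show ?thesis
    proof (cases rule: stack_index_cases)
      case j: (mat c' r')
      show ?thesis using i j \<mu> \<Sigma> scaled[OF \<mu>\<Sigma>[of c' r r']]
        by (simp add: quadro_Qk_index abs_minus_commute right_diff_distrib)
    next
      case j: (vec r')
      have "\<bar>\<Sigma>' $$ (r, r') - \<Sigma> $$ (r, r')\<bar> \<le> 3 * \<Delta>"
        using \<Sigma>_dev[of r r'] i j \<open>0 \<le> \<Delta>\<close> by simp
      from scaled[OF this] show ?thesis using i j \<mu> \<Sigma>
        by (simp add: quadro_Qk_index right_diff_distrib)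
    qed
  qed
qed

text \<open>In the matrix part the two products of means give 3 each and the two covariances 1 each;
  the vector part gives only 4.\<close>

lemma lin_coeff_deviation:
  assumes \<mu>_le: "\<And>i. i < d \<Longrightarrow> \<bar>\<mu>\<^sub>1 $ i\<bar> \<le> 1" "\<And>i. i < d \<Longrightarrow> \<bar>\<mu>\<^sub>1' $ i\<bar> \<le> 2"
      "\<And>i. i < d \<Longrightarrow> \<bar>\<mu>\<^sub>2 $ i\<bar> \<le> 1" "\<And>i. i < d \<Longrightarrow> \<bar>\<mu>\<^sub>2' $ i\<bar> \<le> 2"
    and \<mu>_dev: "\<And>i. i < d \<Longrightarrow> \<bar>\<mu>\<^sub>1' $ i - \<mu>\<^sub>1 $ i\<bar> \<le> \<Delta>" "\<And>i. i < d \<Longrightarrow> \<bar>\<mu>\<^sub>2' $ i - \<mu>\<^sub>2 $ i\<bar> \<le> \<Delta>"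
    and \<Sigma>_dev: "\<And>i j. i < d \<Longrightarrow> j < d \<Longrightarrow> \<bar>\<Sigma>\<^sub>1' $$ (i, j) - \<Sigma>\<^sub>1 $$ (i, j)\<bar> \<le> \<Delta>"
      "\<And>i j. i < d \<Longrightarrow> j < d \<Longrightarrow> \<bar>\<Sigma>\<^sub>2' $$ (i, j) - \<Sigma>\<^sub>2 $$ (i, j)\<bar> \<le> \<Delta>"
    and "i < d * d + d"
  shows "\<bar>lin_coeff d \<mu>\<^sub>1' \<mu>\<^sub>2' \<Sigma>\<^sub>1' \<Sigma>\<^sub>2' i - lin_coeff d \<mu>\<^sub>1 \<mu>\<^sub>2 \<Sigma>\<^sub>1 \<Sigma>\<^sub>2 i\<bar> \<le> 8 * \<Delta>"
  using assms(9)
proof (cases rule: stack_index_cases)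
  case (mat c r)
  have 1: "\<bar>\<mu>\<^sub>1' $ r * \<mu>\<^sub>1' $ c - \<mu>\<^sub>1 $ r * \<mu>\<^sub>1 $ c\<bar> \<le> 3 * \<Delta>"
    using abs_mult_diff_le[OF \<mu>_dev(1) \<mu>_dev(1) \<mu>_le(1,2)] mat by simp
  have 2: "\<bar>\<mu>\<^sub>2' $ r * \<mu>\<^sub>2' $ c - \<mu>\<^sub>2 $ r * \<mu>\<^sub>2 $ c\<bar> \<le> 3 * \<Delta>"
    using abs_mult_diff_le[OF \<mu>_dev(2) \<mu>_dev(2) \<mu>_le(3,4)] mat by simp
  have coeff: "lin_coeff d a b A B i = b $ r * b $ c - a $ r * a $ c - (A $$ (c, r) - B $$ (c, r))"
    for a b A B using mat stack_index_less[of c d r] by (simp add: lin_coeff_def)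
  show ?thesis unfolding coeff using 1 2 \<Sigma>_dev(1)[OF mat(1,2)] \<Sigma>_dev(2)[OF mat(1,2)]
    unfolding abs_le_iff by linarith
next
  case (vec r)
  then show ?thesis
    using \<mu>_dev(1)[OF vec(1)] \<mu>_dev(2)[OF vec(1)] unfolding abs_le_iff by (simp add: lin_coeff_def)
qed

section \<open>Translation of the matrix problem into stacked coordinates\<close>

lemma restricted_eigenvalue_cone:
  assumes carr: "Q \<in> carrier_mat N N" and S: "S \<subseteq> {..<N}"
    and psd: "\<And>v. 0 \<le> bil {..<N} (\<lambda>i j. Q $$ (i, j)) v v"
    and ge: "restricted_eigenvalue Q S g \<ge> a"
  shows "cone_lower_bound {..<N} (\<lambda>i j. Q $$ (i, j)) S g a"
  unfolding cone_lower_bound_def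
proof (intro allI impI)
  fix v assume cone: "l1 ({..<N} - S) v \<le> g * l1 S v"
  let ?B = "bil {..<N} (\<lambda>i j. Q $$ (i, j))"
  have finS: "finite S" using S finite_subset by blast
  have form: "w \<bullet> (Q *\<^sub>v w) = ?B (\<lambda>i. w $ i) (\<lambda>i. w $ i)" if "w \<in> carrier_vec N" for w
    using that carr by (rule scalar_prod_mult_mat_vec[OF that])
  show "a * (\<Sum>i\<in>S. (v i)\<^sup>2) \<le> ?B v v"
  proof (cases "\<exists>i\<in>S. v i \<noteq> 0")
    case False
    then show ?thesis using psd by simp
  next
    case True
    let ?X = "{(v \<bullet> (Q *\<^sub>v v)) / (\<Sum>i\<in>S. (v $ i)\<^sup>2) | v.
     v \<in> carrier_vec (dim_row Q) \<and> (\<exists>i\<in>S. v $ i \<noteq> 0) \<and>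
     (\<Sum>i\<in>{..<dim_row Q} - S. \<bar>v $ i\<bar>) \<le> g * (\<Sum>i\<in>S. \<bar>v $ i\<bar>)}"
    let ?w = "Matrix.vec N v"
    \<comment> \<open>A real infimum is a lower bound only for sets bounded below; here 0 is a bound
      because the form is positive semidefinite.\<close>
    have bdd: "bdd_below ?X"
    proof (rule bdd_belowI[of _ 0])
      fix x assume "x \<in> ?X"
      then obtain u where "u \<in> carrier_vec N" "x = (u \<bullet> (Q *\<^sub>v u)) / (\<Sum>i\<in>S. (u $ i)\<^sup>2)"
        using carr by auto
      then show "0 \<le> x" using psd by (simp add: form sum_nonneg)
    qed
    have inS: "?w $ i = v i" if "i \<in> S" for i using that S by auto
    have sums: "(\<Sum>i\<in>S. (?w $ i)\<^sup>2) = (\<Sum>i\<in>S. (v i)\<^sup>2)" "(\<Sum>i\<in>S. \<bar>?w $ i\<bar>) = l1 S v"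
      "(\<Sum>i\<in>{..<N} - S. \<bar>?w $ i\<bar>) = l1 ({..<N} - S) v"
      unfolding l1_def by (intro sum.cong refl; simp add: inS)+
    have "(?w \<bullet> (Q *\<^sub>v ?w)) / (\<Sum>i\<in>S. (?w $ i)\<^sup>2) \<in> ?X"
    proof (intro CollectI exI conjI)
      show "\<exists>i\<in>S. ?w $ i \<noteq> 0" using True inS by metis
      show "(\<Sum>i\<in>{..<dim_row Q} - S. \<bar>?w $ i\<bar>) \<le> g * (\<Sum>i\<in>S. \<bar>?w $ i\<bar>)"
        unfolding carrier_matD(1)[OF carr] sums by (rule cone)
    qed (use carr in simp_all)
    then have "a \<le> (?w \<bullet> (Q *\<^sub>v ?w)) / (\<Sum>i\<in>S. (?w $ i)\<^sup>2)"
      using ge unfolding restricted_eigenvalue_def by (rule order_trans[OF _ cInf_lower[OF _ bdd], rotated])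
    also have "?w \<bullet> (Q *\<^sub>v ?w) = ?B v v"
      by (subst form) (auto intro: bil_cong)
    finally have "a \<le> ?B v v / (\<Sum>i\<in>S. (v i)\<^sup>2)" by (simp only: sums)
    moreover have "0 < (\<Sum>i\<in>S. (v i)\<^sup>2)"
    proof -
      obtain i where "i \<in> S" "v i \<noteq> 0" using True by blast
      then show ?thesis using finS by (intro sum_pos2[of S i]) auto
    qed
    ultimately show ?thesis by (simp add: le_divide_eq)
  qed
qed

definition quadro_form :: "real \<Rightarrow> real \<Rightarrow> real vec \<Rightarrow> real vec \<Rightarrow> real mat \<Rightarrow> real mat \<Rightarrow> nat \<Rightarrow> nat \<Rightarrow> real" where
  "quadro_form \<gamma> \<kappa> \<mu>\<^sub>1 \<mu>\<^sub>2 \<Sigma>\<^sub>1 \<Sigma>\<^sub>2 i j = quadro_Q \<gamma> \<kappa> \<mu>\<^sub>1 \<mu>\<^sub>2 \<Sigma>\<^sub>1 \<Sigma>\<^sub>2 $$ (i, j)"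

context
  fixes d :: nat and \<mu>\<^sub>1 \<mu>\<^sub>2 :: "real vec" and \<Sigma>\<^sub>1 \<Sigma>\<^sub>2 :: "real mat"
  assumes \<mu>: "\<mu>\<^sub>1 \<in> carrier_vec d" "\<mu>\<^sub>2 \<in> carrier_vec d"
    and \<Sigma>: "pos_semidef d \<Sigma>\<^sub>1" "pos_semidef d \<Sigma>\<^sub>2"
begin

lemma \<Sigma>_carrier: "\<Sigma>\<^sub>1 \<in> carrier_mat d d" "\<Sigma>\<^sub>2 \<in> carrier_mat d d"
  using \<Sigma> by (simp_all add: pos_semidef_def)

lemma quadro_Q_carrier: "quadro_Q \<gamma> \<kappa> \<mu>\<^sub>1 \<mu>\<^sub>2 \<Sigma>\<^sub>1 \<Sigma>\<^sub>2 \<in> carrier_mat (d * d + d) (d * d + d)"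
  using quadro_Qk_carrier[OF \<mu>(1) \<Sigma>_carrier(1)] quadro_Qk_carrier[OF \<mu>(2) \<Sigma>_carrier(2)]
  by (simp add: quadro_Q_def)

lemma quadro_form_eq:
  assumes "i < d * d + d" "j < d * d + d"
  shows "quadro_form \<gamma> \<kappa> \<mu>\<^sub>1 \<mu>\<^sub>2 \<Sigma>\<^sub>1 \<Sigma>\<^sub>2 i j
    = quadro_Qk \<gamma> \<mu>\<^sub>1 \<Sigma>\<^sub>1 $$ (i, j) + \<kappa> * quadro_Qk \<gamma> \<mu>\<^sub>2 \<Sigma>\<^sub>2 $$ (i, j)"
  using carrier_matD[OF quadro_Qk_carrier[OF \<mu>(1) \<Sigma>_carrier(1)]]
    carrier_matD[OF quadro_Qk_carrier[OF \<mu>(2) \<Sigma>_carrier(2)]] assms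
  by (simp add: quadro_form_def quadro_Q_def)

lemma quadro_form_symmetric:
  assumes "i < d * d + d" "j < d * d + d"
  shows "quadro_form \<gamma> \<kappa> \<mu>\<^sub>1 \<mu>\<^sub>2 \<Sigma>\<^sub>1 \<Sigma>\<^sub>2 i j = quadro_form \<gamma> \<kappa> \<mu>\<^sub>1 \<mu>\<^sub>2 \<Sigma>\<^sub>1 \<Sigma>\<^sub>2 j i"
  using quadro_Qk_symmetric[OF \<mu>(1) \<Sigma>(1) assms] quadro_Qk_symmetric[OF \<mu>(2) \<Sigma>(2) assms]
  by (simp add: quadro_form_eq assms)

lemma bil_quadro_form:
  "bil {..<d * d + d} (quadro_form \<gamma> \<kappa> \<mu>\<^sub>1 \<mu>\<^sub>2 \<Sigma>\<^sub>1 \<Sigma>\<^sub>2) v v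
    = quadro_L \<gamma> \<kappa> \<mu>\<^sub>1 \<mu>\<^sub>2 \<Sigma>\<^sub>1 \<Sigma>\<^sub>2 (unstack_mat d v) (unstack_vec d v)"
proof -
  let ?I = "{..<d * d + d}"
  have "bil ?I (quadro_form \<gamma> \<kappa> \<mu>\<^sub>1 \<mu>\<^sub>2 \<Sigma>\<^sub>1 \<Sigma>\<^sub>2) v v
      = (\<Sum>i\<in>?I. \<Sum>j\<in>?I. v i * quadro_Qk \<gamma> \<mu>\<^sub>1 \<Sigma>\<^sub>1 $$ (i, j) * v j
        + \<kappa> * (v i * quadro_Qk \<gamma> \<mu>\<^sub>2 \<Sigma>\<^sub>2 $$ (i, j) * v j))"
    unfolding bil_def by (intro sum.cong refl) (simp add: quadro_form_eq algebra_simps)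
  also have "\<dots> = bil ?I (\<lambda>i j. quadro_Qk \<gamma> \<mu>\<^sub>1 \<Sigma>\<^sub>1 $$ (i, j)) v v
      + \<kappa> * bil ?I (\<lambda>i j. quadro_Qk \<gamma> \<mu>\<^sub>2 \<Sigma>\<^sub>2 $$ (i, j)) v v"
    by (simp only: bil_def sum.distrib sum_distrib_left)
  finally show ?thesis
    by (simp only: bil_quadro_Qk[OF \<mu>(1) \<Sigma>(1)] bil_quadro_Qk[OF \<mu>(2) \<Sigma>(2)] quadro_L_def)
qed

lemma quadro_form_nonneg:
  assumes "\<gamma> \<ge> 0" "\<kappa> \<ge> 0"
  shows "0 \<le> bil {..<d * d + d} (quadro_form \<gamma> \<kappa> \<mu>\<^sub>1 \<mu>\<^sub>2 \<Sigma>\<^sub>1 \<Sigma>\<^sub>2) v v"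
  unfolding bil_quadro_form quadro_L_def
  using quadro_Lk_nonneg[OF \<mu>(1) \<Sigma>(1) assms(1)] quadro_Lk_nonneg[OF \<mu>(2) \<Sigma>(2) assms(1)] assms
  by simp

text \<open>Since \<Omega> ranges over all square matrices, every index function unstacks to an
  admissible pair, so minimality over pairs becomes minimality over all \<open>v\<close> on the
  constraint.\<close>

lemma quadro_solution_stack:
  assumes sol: "quadro_solution d \<gamma> \<kappa> \<mu>\<^sub>1 \<mu>\<^sub>2 \<Sigma>\<^sub>1 \<Sigma>\<^sub>2 l \<Omega> \<delta>"
  defines "I \<equiv> {..<d * d + d}" and "m \<equiv> lin_coeff d \<mu>\<^sub>1 \<mu>\<^sub>2 \<Sigma>\<^sub>1 \<Sigma>\<^sub>2"
    and "Q \<equiv> quadro_form \<gamma> \<kappa> \<mu>\<^sub>1 \<mu>\<^sub>2 \<Sigma>\<^sub>1 \<Sigma>\<^sub>2" and "x \<equiv> \<lambda>i. (vec_stack \<Omega> @\<^sub>v \<delta>) $ i"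
  shows "\<Omega> \<in> carrier_mat d d" "\<delta> \<in> carrier_vec d" "lin I m x = 1"
    "\<And>v. lin I m v = 1 \<Longrightarrow> bil I Q x x + l * l1 I x \<le> bil I Q v v + l * l1 I v"
proof -
  show carr: "\<Omega> \<in> carrier_mat d d" "\<delta> \<in> carrier_vec d"
    using sol by (auto simp: quadro_solution_def is_arg_min_def)
  have x: "unstack_mat d x = \<Omega>" "unstack_vec d x = \<delta>"
    unfolding x_def by (rule unstack_stack[OF carr])+
  have M: "lin I m v = quadro_M \<mu>\<^sub>1 \<mu>\<^sub>2 \<Sigma>\<^sub>1 \<Sigma>\<^sub>2 (unstack_mat d v) (unstack_vec d v)" for v
    unfolding I_def m_def by (rule quadro_M_unstack[OF \<mu> \<Sigma>_carrier, symmetric])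
  show "lin I m x = 1" unfolding M x using sol by (auto simp: quadro_solution_def is_arg_min_def)
  fix v assume v: "lin I m v = 1"
  have obj: "bil I Q v v + l * l1 I v = quadro_L \<gamma> \<kappa> \<mu>\<^sub>1 \<mu>\<^sub>2 \<Sigma>\<^sub>1 \<Sigma>\<^sub>2 (unstack_mat d v) (unstack_vec d v)
      + l * mat_l1 (unstack_mat d v) + l * vec_l1 (unstack_vec d v)" for v
    unfolding I_def Q_def bil_quadro_form l1_unstack[symmetric] by (simp add: distrib_left)
  have "unstack_mat d v \<in> carrier_mat d d" "unstack_vec d v \<in> carrier_vec d"
    by (simp_all add: unstack_mat_def unstack_vec_def)
  then have "\<not> (quadro_L \<gamma> \<kappa> \<mu>\<^sub>1 \<mu>\<^sub>2 \<Sigma>\<^sub>1 \<Sigma>\<^sub>2 (unstack_mat d v) (unstack_vec d v)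
      + l * mat_l1 (unstack_mat d v) + l * vec_l1 (unstack_vec d v)
      < quadro_L \<gamma> \<kappa> \<mu>\<^sub>1 \<mu>\<^sub>2 \<Sigma>\<^sub>1 \<Sigma>\<^sub>2 \<Omega> \<delta> + l * mat_l1 \<Omega> + l * vec_l1 \<delta>)"
    using sol v[unfolded M] by (auto simp: quadro_solution_def is_arg_min_def)
  then show "bil I Q x x + l * l1 I x \<le> bil I Q v v + l * l1 I v"
    unfolding obj x by simp
qed

lemma rayleigh_stack:
  assumes carr: "\<Omega> \<in> carrier_mat d d" "\<delta> \<in> carrier_vec d"
  defines "I \<equiv> {..<d * d + d}" and "x \<equiv> \<lambda>i. (vec_stack \<Omega> @\<^sub>v \<delta>) $ i"
  shows "rayleigh \<gamma> \<kappa> \<mu>\<^sub>1 \<mu>\<^sub>2 \<Sigma>\<^sub>1 \<Sigma>\<^sub>2 \<Omega> \<delta> = (lin I (lin_coeff d \<mu>\<^sub>1 \<mu>\<^sub>2 \<Sigma>\<^sub>1 \<Sigma>\<^sub>2) x)\<^sup>2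
    / bil I (quadro_form \<gamma> \<kappa> \<mu>\<^sub>1 \<mu>\<^sub>2 \<Sigma>\<^sub>1 \<Sigma>\<^sub>2) x x"
  unfolding I_def rayleigh_def bil_quadro_form quadro_M_unstack[OF \<mu> \<Sigma>_carrier, symmetric]
  unfolding x_def unstack_stack[OF carr] ..

end

section \<open>Choice of dimension-free constants and conclusion\<close>

theorem theorem5p1:
  fixes \<pi> \<kappa> \<gamma> a\<^sub>0 c\<^sub>0 u\<^sub>0 :: real
  assumes "0 < \<pi>" and "\<pi> < 1" and "\<kappa> = (1 - \<pi>) / \<pi>" and "\<gamma> \<ge> 0"
    and "a\<^sub>0 > 0" and "c\<^sub>0 > 0" and "u\<^sub>0 > 0"
  shows "\<exists>C > 0. \<exists>A > 0. \<forall>(d::nat) \<mu>\<^sub>1 \<mu>\<^sub>2 \<Sigma>\<^sub>1 \<Sigma>\<^sub>2 \<mu>h\<^sub>1 \<mu>h\<^sub>2 \<Sigma>h\<^sub>1 \<Sigma>h\<^sub>2 (l\<^sub>0::real) \<Omega>o \<delta>o S s\<^sub>0 Ro k\<^sub>0 \<Delta>.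
    d \<ge> 1 \<longrightarrow>
    \<mu>\<^sub>1 \<in> carrier_vec d \<longrightarrow> \<mu>\<^sub>2 \<in> carrier_vec d \<longrightarrow> pos_def d \<Sigma>\<^sub>1 \<longrightarrow> pos_def d \<Sigma>\<^sub>2 \<longrightarrow>
    \<mu>h\<^sub>1 \<in> carrier_vec d \<longrightarrow> \<mu>h\<^sub>2 \<in> carrier_vec d \<longrightarrow> pos_semidef d \<Sigma>h\<^sub>1 \<longrightarrow> pos_semidef d \<Sigma>h\<^sub>2 \<longrightarrow>
    Max {mat_linf \<Sigma>\<^sub>1, mat_linf \<Sigma>\<^sub>2, vec_linf \<mu>\<^sub>1, vec_linf \<mu>\<^sub>2} \<le> 1 \<longrightarrow>
    mat_linf (\<Sigma>h\<^sub>1 - \<Sigma>\<^sub>1) \<le> mat_linf \<Sigma>\<^sub>1 \<longrightarrow> mat_linf (\<Sigma>h\<^sub>2 - \<Sigma>\<^sub>2) \<le> mat_linf \<Sigma>\<^sub>2 \<longrightarrow>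
    vec_linf (\<mu>h\<^sub>1 - \<mu>\<^sub>1) \<le> vec_linf \<mu>\<^sub>1 \<longrightarrow> vec_linf (\<mu>h\<^sub>2 - \<mu>\<^sub>2) \<le> vec_linf \<mu>\<^sub>2 \<longrightarrow>
    l\<^sub>0 \<ge> 0 \<longrightarrow>
    quadro_solution d \<gamma> \<kappa> \<mu>\<^sub>1 \<mu>\<^sub>2 \<Sigma>\<^sub>1 \<Sigma>\<^sub>2 l\<^sub>0 \<Omega>o \<delta>o \<longrightarrow>
    S = vec_support (vec_stack \<Omega>o @\<^sub>v \<delta>o) \<longrightarrow>
    s\<^sub>0 = real (card S) \<longrightarrow>
    Ro = rayleigh \<gamma> \<kappa> \<mu>\<^sub>1 \<mu>\<^sub>2 \<Sigma>\<^sub>1 \<Sigma>\<^sub>2 \<Omega>o \<delta>o \<longrightarrow>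
    k\<^sub>0 = max s\<^sub>0 Ro \<longrightarrow>
    \<Delta> = Max {mat_linf (\<Sigma>h\<^sub>1 - \<Sigma>\<^sub>1), mat_linf (\<Sigma>h\<^sub>2 - \<Sigma>\<^sub>2), vec_linf (\<mu>h\<^sub>1 - \<mu>\<^sub>1), vec_linf (\<mu>h\<^sub>2 - \<mu>\<^sub>2)} \<longrightarrow>
    restricted_eigenvalue (quadro_Q \<gamma> \<kappa> \<mu>\<^sub>1 \<mu>\<^sub>2 \<Sigma>\<^sub>1 \<Sigma>\<^sub>2) S 0 \<ge> c\<^sub>0 \<longrightarrow>
    restricted_eigenvalue (quadro_Q \<gamma> \<kappa> \<mu>\<^sub>1 \<mu>\<^sub>2 \<Sigma>\<^sub>1 \<Sigma>\<^sub>2) S 3 \<ge> a\<^sub>0 \<longrightarrow>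
    Ro \<ge> u\<^sub>0 \<longrightarrow>
    4 * s\<^sub>0 * \<Delta>\<^sup>2 \<le> a\<^sub>0 * c\<^sub>0 \<longrightarrow>
    max (s\<^sub>0 * \<Delta>) (sqrt s\<^sub>0 * sqrt k\<^sub>0 * l\<^sub>0) < 1 \<longrightarrow>
    (\<forall>\<eta> l \<Omega>h \<delta>h.
       \<eta> > 1 \<longrightarrow>
       l = C * \<eta> * max (sqrt s\<^sub>0 * \<Delta>) (sqrt k\<^sub>0 * l\<^sub>0) / sqrt Ro \<longrightarrow>
       quadro_solution d \<gamma> \<kappa> \<mu>h\<^sub>1 \<mu>h\<^sub>2 \<Sigma>h\<^sub>1 \<Sigma>h\<^sub>2 l \<Omega>h \<delta>h \<longrightarrow>
       rayleigh \<gamma> \<kappa> \<mu>\<^sub>1 \<mu>\<^sub>2 \<Sigma>\<^sub>1 \<Sigma>\<^sub>2 \<Omega>h \<delta>h / Ro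
         \<ge> 1 - A * \<eta>\<^sup>2 * max (s\<^sub>0 * \<Delta>) (sqrt s\<^sub>0 * sqrt k\<^sub>0 * l\<^sub>0))"
proof -
  have \<kappa>: "0 \<le> \<kappa>" using assms(1-3) by simp
  \<comment> \<open>Entrywise error of Q per unit of \<Delta>: the same bound for both classes, the
    second weighted by \<kappa>. The 8 in \<open>C\<close> and \<open>A\<close> is the corresponding
    constant for M from \<open>lin_coeff_deviation\<close>. Neither depends on
    \<open>d\<close>.\<close>
  define cq where "cq = (34 + 9 * \<gamma>) * (1 + \<kappa>)"
  define C where "C = 2 * (4 * 8 / sqrt u\<^sub>0 + 3 + 4 * cq / sqrt c\<^sub>0)"
  define A where "A = 3 * (12 * 8 * C / (a\<^sub>0 * sqrt u\<^sub>0)) + 9/4 * (15 * C\<^sup>2 / a\<^sub>0)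
    + 2 * 8 / sqrt (c\<^sub>0 * u\<^sub>0) + 32 * cq / a\<^sub>0"
  have cq: "0 < cq" using \<open>\<gamma> \<ge> 0\<close> \<kappa> by (simp add: cq_def)
  have C: "0 < C" using assms cq by (simp add: C_def add_pos_pos)
  have A: "0 < A" using assms cq C unfolding A_def by (intro add_pos_pos) auto
  show ?thesis
  proof (rule exI[of _ C], rule conjI[OF C], rule exI[of _ A], rule conjI[OF A], intro allI impI)
    fix d :: nat and \<mu>\<^sub>1 \<mu>\<^sub>2 :: "real vec" and \<Sigma>\<^sub>1 \<Sigma>\<^sub>2 :: "real mat" and \<mu>h\<^sub>1 \<mu>h\<^sub>2 :: "real vec"
      and \<Sigma>h\<^sub>1 \<Sigma>h\<^sub>2 :: "real mat" and l\<^sub>0 :: real and \<Omega>o \<delta>o S s\<^sub>0 Ro k\<^sub>0 \<Delta> \<eta> l \<Omega>h \<delta>h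
    assume "d \<ge> 1"
      and \<mu>: "\<mu>\<^sub>1 \<in> carrier_vec d" "\<mu>\<^sub>2 \<in> carrier_vec d" and \<Sigma>: "pos_def d \<Sigma>\<^sub>1" "pos_def d \<Sigma>\<^sub>2"
      and \<mu>h: "\<mu>h\<^sub>1 \<in> carrier_vec d" "\<mu>h\<^sub>2 \<in> carrier_vec d"
      and \<Sigma>h: "pos_semidef d \<Sigma>h\<^sub>1" "pos_semidef d \<Sigma>h\<^sub>2"
      and bound: "Max {mat_linf \<Sigma>\<^sub>1, mat_linf \<Sigma>\<^sub>2, vec_linf \<mu>\<^sub>1, vec_linf \<mu>\<^sub>2} \<le> 1"
      and rel_\<Sigma>: "mat_linf (\<Sigma>h\<^sub>1 - \<Sigma>\<^sub>1) \<le> mat_linf \<Sigma>\<^sub>1" "mat_linf (\<Sigma>h\<^sub>2 - \<Sigma>\<^sub>2) \<le> mat_linf \<Sigma>\<^sub>2"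
      and rel_\<mu>: "vec_linf (\<mu>h\<^sub>1 - \<mu>\<^sub>1) \<le> vec_linf \<mu>\<^sub>1" "vec_linf (\<mu>h\<^sub>2 - \<mu>\<^sub>2) \<le> vec_linf \<mu>\<^sub>2"
      and l\<^sub>0: "l\<^sub>0 \<ge> 0"
      and population: "quadro_solution d \<gamma> \<kappa> \<mu>\<^sub>1 \<mu>\<^sub>2 \<Sigma>\<^sub>1 \<Sigma>\<^sub>2 l\<^sub>0 \<Omega>o \<delta>o"
      and S: "S = vec_support (vec_stack \<Omega>o @\<^sub>v \<delta>o)" and s\<^sub>0: "s\<^sub>0 = real (card S)"
      and Ro: "Ro = rayleigh \<gamma> \<kappa> \<mu>\<^sub>1 \<mu>\<^sub>2 \<Sigma>\<^sub>1 \<Sigma>\<^sub>2 \<Omega>o \<delta>o" and k\<^sub>0: "k\<^sub>0 = max s\<^sub>0 Ro"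
      and \<Delta>: "\<Delta> = Max {mat_linf (\<Sigma>h\<^sub>1 - \<Sigma>\<^sub>1), mat_linf (\<Sigma>h\<^sub>2 - \<Sigma>\<^sub>2), vec_linf (\<mu>h\<^sub>1 - \<mu>\<^sub>1), vec_linf (\<mu>h\<^sub>2 - \<mu>\<^sub>2)}"
      and RE: "restricted_eigenvalue (quadro_Q \<gamma> \<kappa> \<mu>\<^sub>1 \<mu>\<^sub>2 \<Sigma>\<^sub>1 \<Sigma>\<^sub>2) S 0 \<ge> c\<^sub>0"
        "restricted_eigenvalue (quadro_Q \<gamma> \<kappa> \<mu>\<^sub>1 \<mu>\<^sub>2 \<Sigma>\<^sub>1 \<Sigma>\<^sub>2) S 3 \<ge> a\<^sub>0"
      and u\<^sub>0: "Ro \<ge> u\<^sub>0" and "4 * s\<^sub>0 * \<Delta>\<^sup>2 \<le> a\<^sub>0 * c\<^sub>0"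
      and r: "max (s\<^sub>0 * \<Delta>) (sqrt s\<^sub>0 * sqrt k\<^sub>0 * l\<^sub>0) < 1" and \<eta>: "\<eta> > 1"
      and l: "l = C * \<eta> * max (sqrt s\<^sub>0 * \<Delta>) (sqrt k\<^sub>0 * l\<^sub>0) / sqrt Ro"
      and estimate: "quadro_solution d \<gamma> \<kappa> \<mu>h\<^sub>1 \<mu>h\<^sub>2 \<Sigma>h\<^sub>1 \<Sigma>h\<^sub>2 l \<Omega>h \<delta>h"
    have psd_pop: "pos_semidef d \<Sigma>\<^sub>1" "pos_semidef d \<Sigma>\<^sub>2" using \<Sigma> by (simp_all add: pos_def_imp_pos_semidef)
    note \<Sigma>c = \<Sigma>_carrier[OF \<mu> psd_pop] and \<Sigma>hc = \<Sigma>_carrier[OF \<mu>h \<Sigma>h]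
    let ?I = "{..<d * d + d}"
    let ?x = "\<lambda>i. (vec_stack \<Omega>o @\<^sub>v \<delta>o) $ i" and ?y = "\<lambda>i. (vec_stack \<Omega>h @\<^sub>v \<delta>h) $ i"
    let ?m = "lin_coeff d \<mu>\<^sub>1 \<mu>\<^sub>2 \<Sigma>\<^sub>1 \<Sigma>\<^sub>2" and ?mh = "lin_coeff d \<mu>h\<^sub>1 \<mu>h\<^sub>2 \<Sigma>h\<^sub>1 \<Sigma>h\<^sub>2"
    let ?Q = "quadro_form \<gamma> \<kappa> \<mu>\<^sub>1 \<mu>\<^sub>2 \<Sigma>\<^sub>1 \<Sigma>\<^sub>2" and ?Qh = "quadro_form \<gamma> \<kappa> \<mu>h\<^sub>1 \<mu>h\<^sub>2 \<Sigma>h\<^sub>1 \<Sigma>h\<^sub>2"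
    note O = quadro_solution_stack[OF \<mu> psd_pop population] and E = quadro_solution_stack[OF \<mu>h \<Sigma>h estimate]
    have le1: "mat_linf \<Sigma>\<^sub>1 \<le> 1" "mat_linf \<Sigma>\<^sub>2 \<le> 1" "vec_linf \<mu>\<^sub>1 \<le> 1" "vec_linf \<mu>\<^sub>2 \<le> 1"
      using bound by simp_all
    have le\<Delta>: "mat_linf (\<Sigma>h\<^sub>1 - \<Sigma>\<^sub>1) \<le> \<Delta>" "mat_linf (\<Sigma>h\<^sub>2 - \<Sigma>\<^sub>2) \<le> \<Delta>"
      "vec_linf (\<mu>h\<^sub>1 - \<mu>\<^sub>1) \<le> \<Delta>" "vec_linf (\<mu>h\<^sub>2 - \<mu>\<^sub>2) \<le> \<Delta>"
      unfolding \<Delta> by (auto intro: Max_ge)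
    have vec_bounds: "\<bar>a $ i\<bar> \<le> 1" "\<bar>b $ i\<bar> \<le> 2" "\<bar>b $ i - a $ i\<bar> \<le> \<Delta>"
      if "a \<in> carrier_vec d" "b \<in> carrier_vec d" "vec_linf a \<le> 1" "vec_linf (b - a) \<le> vec_linf a"
        "vec_linf (b - a) \<le> \<Delta>" "i < d" for a b :: "real vec" and i
    proof -
      have "\<bar>a $ i\<bar> \<le> vec_linf a" "\<bar>b $ i - a $ i\<bar> \<le> vec_linf (b - a)"
        using vec_linf_index[of i a] vec_linf_index[of i "b - a"] that by auto
      then show "\<bar>a $ i\<bar> \<le> 1" "\<bar>b $ i\<bar> \<le> 2" "\<bar>b $ i - a $ i\<bar> \<le> \<Delta>" using that by linarith+
    qed
    have mat_bounds: "\<bar>a $$ (i, j)\<bar> \<le> 1" "\<bar>b $$ (i, j)\<bar> \<le> 2" "\<bar>b $$ (i, j) - a $$ (i, j)\<bar> \<le> \<Delta>"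
      if "a \<in> carrier_mat d d" "b \<in> carrier_mat d d" "mat_linf a \<le> 1" "mat_linf (b - a) \<le> mat_linf a"
        "mat_linf (b - a) \<le> \<Delta>" "i < d" "j < d" for a b :: "real mat" and i j
    proof -
      have "\<bar>a $$ (i, j)\<bar> \<le> mat_linf a" "\<bar>b $$ (i, j) - a $$ (i, j)\<bar> \<le> mat_linf (b - a)"
        using mat_linf_index[of i a j] mat_linf_index[of i "b - a" j] that by auto
      then show "\<bar>a $$ (i, j)\<bar> \<le> 1" "\<bar>b $$ (i, j)\<bar> \<le> 2" "\<bar>b $$ (i, j) - a $$ (i, j)\<bar> \<le> \<Delta>"
        using that by linarith+
    qed
    note \<mu>1 = vec_bounds[OF \<mu>(1) \<mu>h(1) le1(3) rel_\<mu>(1) le\<Delta>(3)]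
      and \<mu>2 = vec_bounds[OF \<mu>(2) \<mu>h(2) le1(4) rel_\<mu>(2) le\<Delta>(4)]
      and \<Sigma>1 = mat_bounds[OF \<Sigma>c(1) \<Sigma>hc(1) le1(1) rel_\<Sigma>(1) le\<Delta>(1)]
      and \<Sigma>2 = mat_bounds[OF \<Sigma>c(2) \<Sigma>hc(2) le1(2) rel_\<Sigma>(2) le\<Delta>(2)]
    \<comment> \<open>Some entry must exist to bound \<Delta> from below; \<open>d \<ge> 1\<close>
      provides index 0.\<close>
    have \<Delta>0: "0 \<le> \<Delta>" using \<mu>1(3)[of 0] \<open>d \<ge> 1\<close> by linarith
    have dev_bil: "\<bar>?Qh i j - ?Q i j\<bar> \<le> cq * \<Delta>" if "i \<in> ?I" "j \<in> ?I" for i j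
    proof -
      have ij: "i < d * d + d" "j < d * d + d" using that by auto
      let ?e1 = "quadro_Qk \<gamma> \<mu>h\<^sub>1 \<Sigma>h\<^sub>1 $$ (i, j) - quadro_Qk \<gamma> \<mu>\<^sub>1 \<Sigma>\<^sub>1 $$ (i, j)"
      let ?e2 = "quadro_Qk \<gamma> \<mu>h\<^sub>2 \<Sigma>h\<^sub>2 $$ (i, j) - quadro_Qk \<gamma> \<mu>\<^sub>2 \<Sigma>\<^sub>2 $$ (i, j)"
      have "\<bar>?e1\<bar> \<le> (34 + 9 * \<gamma>) * \<Delta>" "\<bar>?e2\<bar> \<le> (34 + 9 * \<gamma>) * \<Delta>"
        using quadro_Qk_deviation[OF \<mu>(1) \<mu>h(1) \<Sigma>c(1) \<Sigma>hc(1) \<open>\<gamma> \<ge> 0\<close> \<Delta>0 \<mu>1(1,2) \<Sigma>1(1,2) \<mu>1(3) \<Sigma>1(3) ij]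
          quadro_Qk_deviation[OF \<mu>(2) \<mu>h(2) \<Sigma>c(2) \<Sigma>hc(2) \<open>\<gamma> \<ge> 0\<close> \<Delta>0 \<mu>2(1,2) \<Sigma>2(1,2) \<mu>2(3) \<Sigma>2(3) ij]
        by blast+
      then have "\<bar>?e1\<bar> + \<kappa> * \<bar>?e2\<bar> \<le> (34 + 9 * \<gamma>) * \<Delta> + \<kappa> * ((34 + 9 * \<gamma>) * \<Delta>)"
        using \<kappa> by (intro add_mono mult_left_mono) auto
      moreover have "?Qh i j - ?Q i j = ?e1 + \<kappa> * ?e2"
        unfolding quadro_form_eq[OF \<mu> psd_pop ij] quadro_form_eq[OF \<mu>h \<Sigma>h ij] by (simp add: algebra_simps)
      moreover have "\<bar>?e1 + \<kappa> * ?e2\<bar> \<le> \<bar>?e1\<bar> + \<kappa> * \<bar>?e2\<bar>"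
        using abs_triangle_ineq[of ?e1 "\<kappa> * ?e2"] \<kappa> by (simp add: abs_mult)
      ultimately show ?thesis by (simp add: cq_def algebra_simps)
    qed
    have dim: "dim_vec (vec_stack \<Omega>o @\<^sub>v \<delta>o) = d * d + d" using O(1,2) by (auto simp: vec_stack_def)
    have S_sub: "S \<subseteq> ?I" and S_zero: "\<And>i. i \<in> ?I - S \<Longrightarrow> ?x i = 0"
      unfolding S vec_support_def dim by auto
    have cone: "cone_lower_bound ?I ?Q S g b"
      if "restricted_eigenvalue (quadro_Q \<gamma> \<kappa> \<mu>\<^sub>1 \<mu>\<^sub>2 \<Sigma>\<^sub>1 \<Sigma>\<^sub>2) S g \<ge> b" for g b
      using restricted_eigenvalue_cone[OF quadro_Q_carrier[OF \<mu> psd_pop] S_sub _ that]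
        quadro_form_nonneg[OF \<mu> psd_pop \<open>\<gamma> \<ge> 0\<close> \<kappa>] by (simp add: quadro_form_def[abs_def])
    have ray: "Ro = 1 / bil ?I ?Q ?x ?x"
      \<comment> \<open>The oracle satisfies \<open>M = 1\<close>, so its Rayleigh quotient is the
        reciprocal of L.\<close>
      unfolding Ro rayleigh_stack[OF \<mu> psd_pop O(1,2)] O(3) by simp
    interpret penalized_rayleigh ?I S ?Q ?Qh ?m ?mh ?x ?y a\<^sub>0 c\<^sub>0 u\<^sub>0 8 cq C A l\<^sub>0 \<Delta> \<eta> s\<^sub>0 Ro k\<^sub>0
      "max (s\<^sub>0 * \<Delta>) (sqrt s\<^sub>0 * sqrt k\<^sub>0 * l\<^sub>0)" l
    proof
      show "\<bar>?mh i - ?m i\<bar> \<le> 8 * \<Delta>" if "i \<in> ?I" for i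
        using lin_coeff_deviation[OF \<mu>1(1,2) \<mu>2(1,2) \<mu>1(3) \<mu>2(3) \<Sigma>1(3) \<Sigma>2(3)] that by simp
      show "?Q i j = ?Q j i" "?Qh i j = ?Qh j i" if "i \<in> ?I" "j \<in> ?I" for i j
        using quadro_form_symmetric[OF \<mu> psd_pop] quadro_form_symmetric[OF \<mu>h \<Sigma>h] that by simp_all
      show "0 \<le> bil ?I ?Q v v" "0 \<le> bil ?I ?Qh v v" for v
        using quadro_form_nonneg[OF \<mu> psd_pop \<open>\<gamma> \<ge> 0\<close> \<kappa>] quadro_form_nonneg[OF \<mu>h \<Sigma>h \<open>\<gamma> \<ge> 0\<close> \<kappa>] by simp_all
      show "bil ?I ?Q ?x ?x + l\<^sub>0 * l1 ?I ?x \<le> bil ?I ?Q v v + l\<^sub>0 * l1 ?I v" if "lin ?I ?m v = 1" for v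
        by (rule O(4)[OF that])
      show "bil ?I ?Qh ?y ?y + l * l1 ?I ?y \<le> bil ?I ?Qh v v + l * l1 ?I v" if "lin ?I ?mh v = 1" for v
        by (rule E(4)[OF that])
    qed (fact finite_lessThan S_sub S_zero assms cq C_def A_def dev_bil \<Delta>0 l\<^sub>0 \<eta> O(3) E(3)
      cone[OF RE(1)] cone[OF RE(2)] s\<^sub>0 ray u\<^sub>0 k\<^sub>0 r l refl | simp)+
    show "rayleigh \<gamma> \<kappa> \<mu>\<^sub>1 \<mu>\<^sub>2 \<Sigma>\<^sub>1 \<Sigma>\<^sub>2 \<Omega>h \<delta>h / Ro
        \<ge> 1 - A * \<eta>\<^sup>2 * max (s\<^sub>0 * \<Delta>) (sqrt s\<^sub>0 * sqrt k\<^sub>0 * l\<^sub>0)"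
      unfolding rayleigh_stack[OF \<mu> psd_pop E(1,2)] divide_divide_eq_left by (rule ratio_bound)
  qed
qed

end
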